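(* Let $M$ be a complex symplectic manifold with a Hamiltonian holomorphic $GL(n,\mathbb C)$-action, and let $\mu:M\to\mathfrak{gl}(n,\mathbb C)$ be the moment map. For $p\in M$ and $1\le i\le m\le n$ denote by $B_{mi}(p)$ the element $\bigl(\mu(p)_{(m)}\bigr)^{i-1}$ of the algebra $\mathfrak{gl}(n,\mathbb C)$. Then the actions of $\mathbb C$ on $M$ given by $$z.p=e^{zB_{mi}(p)}.p,\qquad z\in\mathbb C,$$ commute for the various $m$ and $i$ and induce an action of $\mathbb C^{n(n+1)/2}$ on $M$.
   Context: $\mathfrak{gl}(n,\mathbb C)$ is identified with its dual by the trace form. $B_{(m)}$ denotes the upper-left $m\times m$ block of an $n\times n$ matrix $B$; $\mathfrak{gl}(m,\mathbb C)$ is regarded as the subalgebra of $\mathfrak{gl}(n,\mathbb C)$ of matrices supported in the upper-left $m\times m$ block, so that $(\mu(p)_{(m)})^{i-1}$ (a power taken in $\mathfrak{gl}(m,\mathbb C)$, the zeroth power being the $m\times m$ identity) is extended by zeros to an $n\times n$ matrix. The moment map is assumed equivariant, as usual. *)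

theory Defs
  imports "HOL-Analysis.Analysis" "HOL-Algebra.Group_Action"
begin

section \<open>Finite-dimensional complex normed spaces\<close>

text \<open>
  These are the model spaces of complex manifolds.  The class includes the zero space, so that
  manifolds of dimension zero are not excluded.
\<close>

class complex_fd_space = real_normed_vector +
  fixes scaleC :: "complex \<Rightarrow> 'a \<Rightarrow> 'a"  (infixr "*\<^sub>C" 75)
  assumes scaleC_of_real: "complex_of_real r *\<^sub>C x = r *\<^sub>R x"
    and scaleC_add_right: "a *\<^sub>C (x + y) = a *\<^sub>C x + a *\<^sub>C y"
    and scaleC_add_left: "(a + b) *\<^sub>C x = a *\<^sub>C x + b *\<^sub>C x"
    and scaleC_scaleC: "a *\<^sub>C b *\<^sub>C x = (a * b) *\<^sub>C x"
    and norm_scaleC: "norm (a *\<^sub>C x) = cmod a * norm x"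
    and finite_spanning: "\<exists>B. finite B \<and> (\<forall>x. \<exists>u. x = (\<Sum>b\<in>B. u b *\<^sub>R b))"

lemma finite_spanning_iff:
  "(\<exists>B::'a::real_vector set. finite B \<and> (\<forall>x. \<exists>u. x = (\<Sum>b\<in>B. u b *\<^sub>R b))) \<longleftrightarrow>
   (\<exists>B::'a set. finite B \<and> span B = UNIV)"
proof (rule ex_cong1, rule conj_cong)
  fix B :: "'a set"
  assume "finite B"
  then show "(\<forall>x. \<exists>u. x = (\<Sum>b\<in>B. u b *\<^sub>R b)) \<longleftrightarrow> span B = UNIV"
    unfolding span_finite[OF \<open>finite B\<close>] by (simp add: surj_def)
qed simp

lemma finite_spanning_span: "\<exists>B::'a::complex_fd_space set. finite B \<and> span B = UNIV"
  by (rule iffD1[OF finite_spanning_iff finite_spanning])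

instantiation complex :: complex_fd_space
begin
definition scaleC_complex :: "complex \<Rightarrow> complex \<Rightarrow> complex"
  where "scaleC_complex a x = a * x"
instance
proof
  show "\<exists>B::complex set. finite B \<and> (\<forall>x. \<exists>u. x = (\<Sum>b\<in>B. u b *\<^sub>R b))"
    by (rule iffD2[OF finite_spanning_iff], rule exI[of _ Basis]) simp
qed (simp_all add: scaleC_complex_def algebra_simps norm_mult scaleR_conv_of_real)
end

instantiation prod :: (complex_fd_space, complex_fd_space) complex_fd_space
begin
definition scaleC_prod :: "complex \<Rightarrow> 'a \<times> 'b \<Rightarrow> 'a \<times> 'b"
  where "scaleC_prod a x = (a *\<^sub>C fst x, a *\<^sub>C snd x)"
instance
proof
  show "norm (a *\<^sub>C x) = cmod a * norm x" for a and x :: "'a \<times> 'b"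
  proof -
    have "norm (a *\<^sub>C x) = sqrt ((cmod a)\<^sup>2 * ((norm (fst x))\<^sup>2 + (norm (snd x))\<^sup>2))"
      by (simp add: scaleC_prod_def norm_prod_def norm_scaleC power_mult_distrib distrib_left)
    then show ?thesis by (simp add: real_sqrt_mult norm_prod_def)
  qed
  obtain B :: "'a set" where B: "finite B" "span B = UNIV"
    using finite_spanning_span[where 'a = 'a] by blast
  obtain C :: "'b set" where C: "finite C" "span C = UNIV"
    using finite_spanning_span[where 'a = 'b] by blast
  let ?D = "(\<lambda>b. (b, 0)) ` B \<union> (\<lambda>c. (0, c)) ` C"
  have l1: "linear (\<lambda>b::'a. (b, 0::'b))" and l2: "linear (\<lambda>c::'b. (0::'a, c))"
    by (auto intro!: linearI)
  have "(x, y) \<in> span ?D" for x y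
  proof -
    have "(x, 0) \<in> span ((\<lambda>b. (b, 0::'b)) ` B)"
      using B(2) linear_span_image[OF l1, of B] by auto
    moreover have "(0, y) \<in> span ((\<lambda>c. (0::'a, c)) ` C)"
      using C(2) linear_span_image[OF l2, of C] by auto
    ultimately have "(x, 0) + (0, y) \<in> span ?D"
      by (meson Un_upper1 Un_upper2 span_add span_mono subsetD)
    then show ?thesis by simp
  qed
  then have "span ?D = UNIV" by auto
  then have "\<exists>D::('a \<times> 'b) set. finite D \<and> span D = UNIV"
    using B(1) C(1) by (metis finite_UnI finite_imageI)
  then show "\<exists>B::('a \<times> 'b) set. finite B \<and> (\<forall>x. \<exists>u. x = (\<Sum>b\<in>B. u b *\<^sub>R b))"
        by (rule iffD2[OF finite_spanning_iff])
qed (auto simp: scaleC_prod_def scaleC_of_real scaleC_add_right scaleC_add_left scaleC_scaleC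
    prod_eq_iff)
end

instantiation vec :: (complex_fd_space, finite) complex_fd_space
begin
definition scaleC_vec :: "complex \<Rightarrow> 'a ^ 'b \<Rightarrow> 'a ^ 'b"
  where "scaleC_vec a x = (\<chi> i. a *\<^sub>C x $ i)"
instance
proof
  show "norm (a *\<^sub>C x) = cmod a * norm x" for a and x :: "'a ^ 'b"
    by (simp add: scaleC_vec_def norm_vec_def norm_scaleC L2_set_right_distrib)
  obtain B :: "'a set" where B: "finite B" "span B = UNIV"
    using finite_spanning_span[where 'a = 'a] by blast
  let ?D = "(\<Union>i::'b. axis i ` B)"
  have l: "linear (axis i :: 'a \<Rightarrow> 'a ^ 'b)" for i
    by (auto intro!: linearI simp: axis_def vec_eq_iff)
  have "x \<in> span ?D" for x :: "'a ^ 'b"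
  proof -
    have "axis i (x $ i) \<in> span ?D" for i
    proof -
      have "axis i (x $ i) \<in> span (axis i ` B)"
        using B(2) linear_span_image[OF l, of i B] by auto
      then show ?thesis
        by (meson UN_upper UNIV_I span_mono subsetD)
    qed
    then have "(\<Sum>i\<in>UNIV. axis i (x $ i)) \<in> span ?D" by (intro span_sum)
    moreover have "(\<Sum>i\<in>UNIV. axis i (x $ i)) = x"
      by (simp add: vec_eq_iff axis_def)
    ultimately show ?thesis by simp
  qed
  then have "span ?D = UNIV" by auto
  moreover have "finite ?D"
    by (intro finite_UN_I finite_imageI B(1)) simp
  ultimately have "\<exists>D::('a ^ 'b) set. finite D \<and> span D = UNIV"
    by blast
  then show "\<exists>B::('a ^ 'b) set. finite B \<and> (\<forall>x. \<exists>u. x = (\<Sum>b\<in>B. u b *\<^sub>R b))"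
        by (rule iffD2[OF finite_spanning_iff])
qed (auto simp: scaleC_vec_def scaleC_of_real scaleC_add_right scaleC_add_left scaleC_scaleC
    vec_eq_iff)
end

definition complex_linear :: "('a::complex_fd_space \<Rightarrow> 'b::complex_fd_space) \<Rightarrow> bool"
  where "complex_linear f \<longleftrightarrow> linear f \<and> (\<forall>a x. f (a *\<^sub>C x) = a *\<^sub>C f x)"

text \<open>Only meaningful for open sets.\<close>

definition cholomorphic_on ::
    "('a::complex_fd_space \<Rightarrow> 'b::complex_fd_space) \<Rightarrow> 'a set \<Rightarrow> bool"
  where "cholomorphic_on f S \<longleftrightarrow> (\<forall>x\<in>S. \<exists>D. (f has_derivative D) (at x) \<and> complex_linear D)"


section \<open>Complex manifolds\<close>

text \<open>A chart is given by its domain and its coordinate map, the values of the latter outside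
  the domain being irrelevant.\<close>

type_synonym ('m, 'e) chart = "'m set \<times> ('m \<Rightarrow> 'e)"

abbreviation dom_chart :: "('m, 'e) chart \<Rightarrow> 'm set" where "dom_chart \<equiv> fst"
abbreviation coord :: "('m, 'e) chart \<Rightarrow> 'm \<Rightarrow> 'e" where "coord \<equiv> snd"

definition chart_image :: "('m, 'e) chart \<Rightarrow> 'e set"
  where "chart_image c = coord c ` dom_chart c"

definition chart_inv :: "('m, 'e) chart \<Rightarrow> 'e \<Rightarrow> 'm"
  where "chart_inv c = inv_into (dom_chart c) (coord c)"

definition is_chart :: "('m::topological_space, 'e::complex_fd_space) chart \<Rightarrow> bool"
  where "is_chart c \<longleftrightarrow> open (dom_chart c) \<and> open (chart_image c) \<and>
    homeomorphism (dom_chart c) (chart_image c) (coord c) (chart_inv c)"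

definition transition :: "('m, 'e) chart \<Rightarrow> ('m, 'e) chart \<Rightarrow> 'e \<Rightarrow> 'e"
  where "transition c d = coord d \<circ> chart_inv c"

text \<open>
  \<open>M\<close> is an open subset of the ambient type, which carries the topology; the atlas \<open>A\<close> need
  not be maximal.
\<close>

definition complex_manifold ::
    "'m::{t2_space, second_countable_topology} set \<Rightarrow> ('m, 'e::complex_fd_space) chart set \<Rightarrow> bool"
  where "complex_manifold M A \<longleftrightarrow>
    (\<forall>c\<in>A. is_chart c) \<and> (\<Union>c\<in>A. dom_chart c) = M \<and>
    (\<forall>c\<in>A. \<forall>d\<in>A. cholomorphic_on (transition c d) (coord c ` (dom_chart c \<inter> dom_chart d)))"

definition holomorphic_map ::
    "'m::topological_space set \<Rightarrow> ('m, 'e::complex_fd_space) chart set \<Rightarrow>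
     'k::topological_space set \<Rightarrow> ('k, 'f::complex_fd_space) chart set \<Rightarrow> ('m \<Rightarrow> 'k) \<Rightarrow> bool"
  where "holomorphic_map M A N B f \<longleftrightarrow>
    f ` M \<subseteq> N \<and> continuous_on M f \<and>
    (\<forall>c\<in>A. \<forall>d\<in>B. cholomorphic_on (coord d \<circ> f \<circ> chart_inv c)
      (coord c ` (dom_chart c \<inter> f -` dom_chart d)))"

text \<open>The atlas of an open subset of a vector space.\<close>

definition open_atlas :: "'e set \<Rightarrow> ('e, 'e) chart set"
  where "open_atlas S = {(S, \<lambda>x. x)}"

definition prod_atlas ::
    "('m, 'e) chart set \<Rightarrow> ('k, 'f) chart set \<Rightarrow> ('m \<times> 'k, 'e \<times> 'f) chart set"
  where "prod_atlas A B =
    {(dom_chart c \<times> dom_chart d, map_prod (coord c) (coord d)) | c d. c \<in> A \<and> d \<in> B}"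


section \<open>Holomorphic symplectic forms\<close>

text \<open>
  A holomorphic 2-form is given by its local representatives: in the chart \<open>c\<close>, at the
  point with coordinates \<open>x\<close>, it is the bilinear form \<open>\<omega> c x\<close> on the model space.
  The representatives are related by pullback along the transition maps.
\<close>

type_synonym ('m, 'e) two_form = "('m, 'e) chart \<Rightarrow> 'e \<Rightarrow> 'e \<Rightarrow> 'e \<Rightarrow> complex"

definition holomorphic_two_form ::
    "('m, 'e::complex_fd_space) chart set \<Rightarrow> ('m, 'e) two_form \<Rightarrow> bool"
  where "holomorphic_two_form A \<omega> \<longleftrightarrow>
    (\<forall>c\<in>A. \<forall>x\<in>chart_image c.
      (\<forall>v. complex_linear (\<lambda>u. \<omega> c x u v)) \<and>
      (\<forall>u. complex_linear (\<lambda>v. \<omega> c x u v)) \<and>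
      (\<forall>u. \<omega> c x u u = 0)) \<and>
    (\<forall>c\<in>A. \<forall>u v. cholomorphic_on (\<lambda>x. \<omega> c x u v) (chart_image c)) \<and>
    (\<forall>c\<in>A. \<forall>d\<in>A. \<forall>x\<in>coord c ` (dom_chart c \<inter> dom_chart d). \<forall>u v.
      \<omega> c x u v =
        \<omega> d (transition c d x)
          (frechet_derivative (transition c d) (at x) u)
          (frechet_derivative (transition c d) (at x) v))"

text \<open>The exterior derivative of \<open>\<omega>\<close> evaluated on constant vector fields of a chart,
  whose Lie brackets vanish.\<close>

definition closed_two_form :: "('m, 'e::complex_fd_space) chart set \<Rightarrow> ('m, 'e) two_form \<Rightarrow> bool"
  where "closed_two_form A \<omega> \<longleftrightarrow>
    (\<forall>c\<in>A. \<forall>x\<in>chart_image c. \<forall>u v w.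
      frechet_derivative (\<lambda>y. \<omega> c y v w) (at x) u +
      frechet_derivative (\<lambda>y. \<omega> c y w u) (at x) v +
      frechet_derivative (\<lambda>y. \<omega> c y u v) (at x) w = 0)"

definition nondegenerate_two_form ::
    "('m, 'e::complex_fd_space) chart set \<Rightarrow> ('m, 'e) two_form \<Rightarrow> bool"
  where "nondegenerate_two_form A \<omega> \<longleftrightarrow>
    (\<forall>c\<in>A. \<forall>x\<in>chart_image c. \<forall>u. (\<forall>v. \<omega> c x u v = 0) \<longrightarrow> u = 0)"

definition complex_symplectic_manifold ::
    "'m::{t2_space, second_countable_topology} set \<Rightarrow> ('m, 'e::complex_fd_space) chart set \<Rightarrow>
     ('m, 'e) two_form \<Rightarrow> bool"
  where "complex_symplectic_manifold M A \<omega> \<longleftrightarrow>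
    complex_manifold M A \<and> holomorphic_two_form A \<omega> \<and> closed_two_form A \<omega> \<and>
    nondegenerate_two_form A \<omega>"


type_synonym 'n cmat = "((complex, 'n) vec, 'n) vec"


section \<open>Holomorphic actions\<close>

text \<open>\<open>AG\<close> is an atlas of the complex Lie group \<open>G\<close>.\<close>

definition holomorphic_action ::
    "('g::topological_space, 'b) monoid_scheme \<Rightarrow> ('g, 'f::complex_fd_space) chart set \<Rightarrow>
     'm::topological_space set \<Rightarrow> ('m, 'e::complex_fd_space) chart set \<Rightarrow>
     ('g \<Rightarrow> 'm \<Rightarrow> 'm) \<Rightarrow> bool"
  where "holomorphic_action G AG M A act \<longleftrightarrow>
    group_action G M act \<and>
    holomorphic_map (carrier G \<times> M) (prod_atlas AG A) M A (\<lambda>(g, p). act g p)"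

definition GL :: "'n::finite cmat monoid"
  where "GL = \<lparr>carrier = {g. invertible g}, mult = (**), one = mat 1\<rparr>"

definition additive_group :: "'a::ab_group_add monoid"
  where "additive_group = \<lparr>carrier = UNIV, mult = (+), one = 0\<rparr>"

definition GL_action ::
    "'m::topological_space set \<Rightarrow> ('m, 'e::complex_fd_space) chart set \<Rightarrow>
     ('n::finite cmat \<Rightarrow> 'm \<Rightarrow> 'm) \<Rightarrow> bool"
  where "GL_action M A act \<longleftrightarrow> holomorphic_action GL (open_atlas (carrier GL)) M A act"

definition vector_space_action ::
    "'m::topological_space set \<Rightarrow> ('m, 'e::complex_fd_space) chart set \<Rightarrow>
     ('v::complex_fd_space \<Rightarrow> 'm \<Rightarrow> 'm) \<Rightarrow> bool"
  where "vector_space_action M A act \<longleftrightarrow>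
    holomorphic_action (additive_group :: 'v monoid) (open_atlas UNIV) M A act"


section \<open>Moment maps\<close>

definition mexp :: "'n::finite cmat \<Rightarrow> 'n::finite cmat"
  where "mexp X = (\<Sum>k. (1 / fact k) *\<^sub>R (((**) X ^^ k) (mat 1)))"

text \<open>The vector at \<open>p\<close> of the vector field generated by \<open>X\<close>, in the chart \<open>c\<close> around \<open>p\<close>.\<close>

definition fundamental_vector ::
    "('n::finite cmat \<Rightarrow> 'm \<Rightarrow> 'm) \<Rightarrow> ('m, 'e::complex_fd_space) chart \<Rightarrow>
     'n::finite cmat \<Rightarrow> 'm \<Rightarrow> 'e"
  where "fundamental_vector act c X p =
    vector_derivative (\<lambda>t::real. coord c (act (mexp (t *\<^sub>R X)) p)) (at 0)"

text \<open>
  The dual of \<open>gl(n)\<close> is identified with \<open>gl(n)\<close> by the trace form, so that the component of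
  \<open>\<mu>\<close> along \<open>X\<close> is \<open>trace (\<mu> p ** X)\<close> and the coadjoint action is conjugation.
  The opposite sign convention in the equation relating \<open>\<mu>\<close> and \<open>\<omega>\<close> amounts to replacing
  \<open>\<omega>\<close> by \<open>- \<omega>\<close>.
\<close>

definition equivariant_moment_map ::
    "'m::topological_space set \<Rightarrow> ('m, 'e::complex_fd_space) chart set \<Rightarrow> ('m, 'e) two_form \<Rightarrow>
     ('n::finite cmat \<Rightarrow> 'm \<Rightarrow> 'm) \<Rightarrow> ('m \<Rightarrow> 'n::finite cmat) \<Rightarrow> bool"
  where "equivariant_moment_map M A \<omega> act \<mu> \<longleftrightarrow>
    holomorphic_map M A UNIV (open_atlas UNIV) \<mu> \<and>
    (\<forall>c\<in>A. \<forall>p\<in>dom_chart c. \<forall>X v.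
      frechet_derivative (\<lambda>x. trace (\<mu> (chart_inv c x) ** X)) (at (coord c p)) v =
      \<omega> c (coord c p) (fundamental_vector act c X p) v) \<and>
    (\<forall>g\<in>carrier GL. \<forall>p\<in>M. \<mu> (act g p) = g ** \<mu> p ** matrix_inv g)"


section \<open>The Gelfand--Zeitlin flows\<close>

text \<open>The position, counted from 1, of an index of an \<open>n \<times> n\<close> matrix.\<close>

definition pos :: "'n::{finite, linorder} \<Rightarrow> nat"
  where "pos a = card {b. b \<le> a}"

text \<open>The upper-left \<open>m \<times> m\<close> block, extended by zeros.\<close>

definition upper_block :: "nat \<Rightarrow> 'n::{finite, linorder} cmat \<Rightarrow> 'n cmat"
  where "upper_block m X = (\<chi> a b. if pos a \<le> m \<and> pos b \<le> m then X $ a $ b else 0)"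

text \<open>The powers are those of \<open>gl(m)\<close>; the zeroth one is the identity of \<open>gl(m)\<close>.\<close>

definition block_power ::
    "nat \<Rightarrow> nat \<Rightarrow> 'n::{finite, linorder} cmat \<Rightarrow> 'n cmat"
  where "block_power m k X = (((**) (upper_block m X)) ^^ k) (upper_block m (mat 1))"

definition gz_flow ::
    "'m set \<Rightarrow> ('n::{finite, linorder} cmat \<Rightarrow> 'm \<Rightarrow> 'm) \<Rightarrow>
     ('m \<Rightarrow> 'n cmat) \<Rightarrow> nat \<Rightarrow> nat \<Rightarrow> complex \<Rightarrow> 'm \<Rightarrow> 'm"
  where "gz_flow M act \<mu> m i z =
    (\<lambda>p\<in>M. act (mexp (z *\<^sub>C block_power m (i - 1) (\<mu> p))) p)"

text \<open>The pairs \<open>(m, i)\<close> with \<open>1 \<le> i \<le> m \<le> n\<close>, where \<open>n = CARD('n)\<close>, as an index type.\<close>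

typedef ('n::finite) gz_index = "{(m, i). 1 \<le> i \<and> i \<le> m \<and> m \<le> CARD('n)} :: (nat \<times> nat) set"
proof
  show "(1, 1) \<in> {(m, i). 1 \<le> i \<and> i \<le> m \<and> m \<le> CARD('n)}" by (simp add: Suc_leI)
qed

lemma gz_index_set:
  "{(m, i). 1 \<le> i \<and> i \<le> m \<and> m \<le> n} = (SIGMA m:{1..n}. {1..m})" for n :: nat
  by auto

instance gz_index :: (finite) finite
proof
  have "finite (Abs_gz_index ` {(m, i). 1 \<le> i \<and> i \<le> m \<and> m \<le> CARD('a)} :: 'a gz_index set)"
    unfolding gz_index_set by auto
  then show "finite (UNIV :: 'a gz_index set)"
    by (simp only: type_definition.Abs_image[OF type_definition_gz_index])
qed

lemma card_gz_index: "CARD('n::finite gz_index) = CARD('n) * (CARD('n) + 1) div 2"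
proof -
  have "CARD('n gz_index) = card {(m, i). 1 \<le> i \<and> i \<le> m \<and> m \<le> CARD('n)}"
    by (rule type_definition.card[OF type_definition_gz_index])
  also have "\<dots> = (\<Sum>m\<in>{1..CARD('n)}. m)"
    unfolding gz_index_set by simp
  also have "\<dots> = CARD('n) * (CARD('n) + 1) div 2"
    using gauss_sum_from_Suc_0[of "CARD('n)", where 'a = nat] by simp
  finally show ?thesis .
qed

end

(* The flow with index (m, i) moves p by an element of GL(m) commuting with the m-th block of
   mu p; by equivariance it therefore leaves that block, and all smaller ones, unchanged, so it is
   a one-parameter group that fixes the generators B_lj for l <= m. An element h of GL(l) with
   l <= m conjugates the m-th block of mu p, hence B_mi(h p) = h B_mi(p) h^-1, and
   exp(z B_mi(h p)) h p = h exp(z B_mi(p)) p gives commutation. The joint action is the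
   composition of the flows, and it is determined by its values on the coordinate axes. *)

theory Submission
  imports Defs
begin

section \<open>The matrix exponential\<close>

text \<open>The generator of a flow varies with \<open>p\<close>, so holomorphy in (z, p) is not
  inherited from a one-parameter subgroup of \<open>GL\<close>. It is obtained by factoring the flow
  through GL x M, and this needs complex differentiability of \<open>mexp\<close> on all of gl(n),
  where a matrix and its increment do not commute; hence the term-by-term differentiation of the
  exponential series. Blocks become matrix algebra through the projector E_m =
  \<open>upper_block m (mat 1)\<close>: the m-th block of X is E_m X E_m, and an invertible matrix
  commuting with E_m conjugates X and its block alike. An element C of gl(l) with l \<le> m
  satisfies E_m C = C = C E_m. Its exponential has ones on the rest of the diagonal and so lies in
  gl(m) only when m = n, but it still commutes with E_m; this is why it acts on the m-th block by
  conjugation. The passage from single flows to one action of C^(n(n+1)/2) is carried out for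
  arbitrary finite families of commuting holomorphic actions of C.\<close>

abbreviation mpow :: "'n::finite cmat \<Rightarrow> nat \<Rightarrow> 'n cmat"
  where "mpow X k \<equiv> ((**) X ^^ k) (mat 1)"

lemma scaleC_mat_nth: "(z *\<^sub>C X) $ a $ b = z * X $ a $ b" for X :: "complex ^ 'n::finite ^ 'm::finite"
  by (simp add: scaleC_vec_def scaleC_complex_def)

lemma scaleC_mat_mult: "(z *\<^sub>C X) ** Y = z *\<^sub>C (X ** Y)" for X Y :: "'n::finite cmat"
  by (simp add: vec_eq_iff scaleC_mat_nth matrix_matrix_mult_def sum_distrib_left mult_ac)

lemma mat_mult_scaleC: "X ** (z *\<^sub>C Y) = z *\<^sub>C (X ** Y)" for X Y :: "'n::finite cmat"
  by (simp add: vec_eq_iff scaleC_mat_nth matrix_matrix_mult_def sum_distrib_left mult_ac)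

text \<open>In finite dimension bilinearity already gives boundedness. The product rule, the
  continuity of one-sided multiplication and the constant \<open>K\<close> of
  \<open>mpow_bounds\<close> come from here.\<close>

lemma bounded_bilinear_matrix_mult:
  "bounded_bilinear ((**) :: 'n::finite cmat \<Rightarrow> 'n cmat \<Rightarrow> 'n cmat)"
  unfolding bilinear_conv_bounded_bilinear[symmetric] bilinear_def
  by (auto intro!: linearI
      simp: vec_eq_iff matrix_matrix_mult_def algebra_simps sum.distrib scaleR_sum_right)

lemmas mat_mult_bounded_linear_right =
  bounded_bilinear.bounded_linear_right[OF bounded_bilinear_matrix_mult]
lemmas mat_mult_bounded_linear_left =
  bounded_bilinear.bounded_linear_left[OF bounded_bilinear_matrix_mult]

lemma bounded_linear_scaleC: "bounded_linear (\<lambda>x::'a::complex_fd_space. z *\<^sub>C x)"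
proof (rule bounded_linear_intro[where K = "cmod z"])
  show "z *\<^sub>C (r *\<^sub>R x) = r *\<^sub>R (z *\<^sub>C x)" for r and x :: 'a
    by (simp add: scaleC_of_real[symmetric] scaleC_scaleC mult.commute)
qed (simp_all add: scaleC_add_right norm_scaleC mult.commute)

lemma mpow_scaleC: "mpow (z *\<^sub>C X) k = z ^ k *\<^sub>C mpow X k"
proof (induction k)
  case 0
  show ?case by (simp add: vec_eq_iff scaleC_mat_nth)
next
  case (Suc k)
  then show ?case
    by (simp add: scaleC_mat_mult mat_mult_scaleC scaleC_scaleC mult.commute)
qed

lemma mpow_add: "mpow X (k + l) = mpow X k ** mpow X l"
  by (induction k) (simp_all add: matrix_mul_assoc)

lemma mpow_intertwine:
  "K ** X = X' ** K \<Longrightarrow> K ** mpow X k = mpow X' k ** K" for K :: "'n::finite cmat"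
proof (induction k)
  case (Suc k)
  then show ?case by (simp add: matrix_mul_assoc) (metis matrix_mul_assoc)
qed simp

text \<open>The differential of the k-th power at \<open>X\<close> in direction \<open>V\<close>,
  that is the sum of X^i V X^(k-1-i) over i < k. The recursion mirrors the product rule and keeps
  the order of the factors, since \<open>X\<close> and \<open>V\<close> need not commute.\<close>

primrec mpow_deriv :: "'n::finite cmat \<Rightarrow> 'n cmat \<Rightarrow> nat \<Rightarrow> 'n cmat"
  where "mpow_deriv X V 0 = 0"
  | "mpow_deriv X V (Suc k) = V ** mpow X k + X ** mpow_deriv X V k"

lemma has_derivative_mpow:
  "((\<lambda>X. mpow X k) has_derivative (\<lambda>V. mpow_deriv X V k)) (at X within S)"
proof (induction k)
  case (Suc k)
  have "((\<lambda>X. X ** mpow X k) has_derivative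
      (\<lambda>V. X ** mpow_deriv X V k + V ** mpow X k)) (at X within S)"
    by (intro bounded_bilinear.FDERIV[OF bounded_bilinear_matrix_mult] has_derivative_ident Suc)
  then show ?case by (simp add: add.commute)
qed simp

lemma mpow_deriv_scaleC: "mpow_deriv X (z *\<^sub>C V) k = z *\<^sub>C mpow_deriv X V k"
proof (induction k)
  case 0
  show ?case by (simp add: vec_eq_iff scaleC_mat_nth)
next
  case (Suc k)
  then show ?case by (simp add: scaleC_mat_mult mat_mult_scaleC scaleC_add_right)
qed

text \<open>Majorants uniform over the ball of radius \<open>R\<close>: powers and their
  differentials grow at most geometrically, so division by factorials makes both series converge
  uniformly there, the second one relative to \<open>norm V\<close>.\<close>

lemma mpow_bounds:
  fixes R :: real
  obtains r c :: real where "0 \<le> r" "0 \<le> c"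
    "\<And>(X::'n::finite cmat) k. norm X \<le> R \<Longrightarrow> norm (mpow X k) \<le> c * r ^ k"
    "\<And>(X::'n cmat) V k. norm X \<le> R \<Longrightarrow> norm (mpow_deriv X V k) \<le> c * r ^ k * norm V"
proof -
  obtain K where K: "0 < K" "\<And>(A :: 'n cmat) (B :: 'n cmat). norm (A ** B) \<le> norm A * norm B * K"
    using bounded_bilinear.pos_bounded[OF bounded_bilinear_matrix_mult[where 'n = 'n]] by auto
  define c where "c = norm (mat 1 :: 'n cmat)"
  \<comment> \<open>The summand 1 gives \<open>K \<le> r\<close>, so that a factor \<open>r\<close>
    can also absorb the constant \<open>K\<close> arising from the product
    \<open>V ** mpow X k\<close>.\<close>
  define r where "r = K * (\<bar>R\<bar> + 1)"
  have r: "0 \<le> r" "K \<le> r" using K(1) by (simp_all add: r_def)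
  have c: "0 \<le> c" by (simp add: c_def)
  have mult: "norm (X ** Y) \<le> r * norm Y" if "norm X \<le> R" for X Y :: "'n cmat"
  proof -
    have "norm (X ** Y) \<le> norm X * norm Y * K" by (rule K(2))
    also have "\<dots> \<le> (\<bar>R\<bar> + 1) * norm Y * K"
      using that K(1) by (intro mult_right_mono) auto
    finally show ?thesis by (simp add: r_def mult_ac)
  qed
  have p: "norm (mpow X k) \<le> c * r ^ k" if "norm X \<le> R" for X :: "'n cmat" and k
  proof (induction k)
    case (Suc k)
    have "norm (mpow X (Suc k)) \<le> r * norm (mpow X k)"
      using mult[OF that] by simp
    also have "\<dots> \<le> r * (c * r ^ k)" by (rule mult_left_mono[OF Suc r(1)])
    finally show ?case by (simp add: mult_ac)
  qed (simp add: c_def)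
  have d: "norm (mpow_deriv X V k) \<le> real k * (c * r ^ k * norm V)" if "norm X \<le> R"
    for X V :: "'n cmat" and k
  proof (induction k)
    case (Suc k)
    have "norm (V ** mpow X k) \<le> norm V * norm (mpow X k) * K" by (rule K(2))
    also have "\<dots> \<le> norm V * (c * r ^ k) * r"
      using p[OF that] r K(1) c by (intro mult_mono mult_nonneg_nonneg) auto
    finally have 1: "norm (V ** mpow X k) \<le> c * r ^ Suc k * norm V" by (simp add: mult_ac)
    have "norm (X ** mpow_deriv X V k) \<le> r * norm (mpow_deriv X V k)" by (rule mult[OF that])
    also have "\<dots> \<le> r * (real k * (c * r ^ k * norm V))" by (rule mult_left_mono[OF Suc r(1)])
    finally have 2: "norm (X ** mpow_deriv X V k) \<le> real k * (c * r ^ Suc k * norm V)"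
      by (simp add: mult_ac)
    have "norm (mpow_deriv X V (Suc k)) \<le> c * r ^ Suc k * norm V + real k * (c * r ^ Suc k * norm V)"
      using norm_triangle_le[OF add_mono[OF 1 2]] by simp
    then show ?case by (simp add: algebra_simps)
  qed simp
  show thesis
  \<comment> \<open>The product rule produced a factor k; doubling \<open>r\<close> absorbs it
    because k \<le> 2^k.\<close>
  proof (rule that[of "2 * r" c])
    fix X V :: "'n cmat" and k
    assume X: "norm X \<le> R"
    have "r ^ k \<le> (2 * r) ^ k" using r by (intro power_mono) auto
    then show "norm (mpow X k) \<le> c * (2 * r) ^ k"
      using order_trans[OF p[OF X, of k] mult_left_mono[OF _ c]] by simp
    have "real k \<le> 2 ^ k" using of_nat_less_two_power[of k, where 'a = real] by simp
    then have "real k * (c * r ^ k * norm V) \<le> 2 ^ k * (c * r ^ k * norm V)"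
      using c r by (intro mult_right_mono mult_nonneg_nonneg) auto
    then show "norm (mpow_deriv X V k) \<le> c * (2 * r) ^ k * norm V"
      using d[OF X, of V k] by (simp add: power_mult_distrib mult_ac)
  qed (use r c in auto)
qed

lemma summable_power_over_fact: "summable (\<lambda>k. c * r ^ k / fact k)" for r c :: real
  using summable_mult[OF summable_exp[of r], of c] by (simp add: divide_inverse mult_ac)

lemma summable_norm_mexp: "summable (\<lambda>k. norm ((1 / fact k) *\<^sub>R mpow X k))"
proof -
  obtain r c where rc: "0 \<le> r" "0 \<le> c" "\<And>k. norm (mpow X k) \<le> c * r ^ k"
    using mpow_bounds[of "norm X", where 'n = 'a] by (metis order_refl)
  show ?thesis
    by (rule summable_comparison_test'[OF summable_power_over_fact[of c r]])
       (simp add: rc divide_right_mono)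
qed

lemma mexp_sums: "(\<lambda>k. (1 / fact k) *\<^sub>R mpow X k) sums mexp X"
  unfolding mexp_def by (rule summable_sums[OF summable_norm_cancel[OF summable_norm_mexp]])

text \<open>The relation passes to powers and then, multiplication by \<open>K\<close> being
  continuous, to the series. In this inverse-free form it serves for commutation
  (\<open>X = X'\<close>) as well as for conjugation.\<close>

lemma mexp_intertwine:
  fixes K :: "'n::finite cmat"
  assumes "K ** X = X' ** K"
  shows "K ** mexp X = mexp X' ** K"
proof (rule sums_unique2)
  show "(\<lambda>k. K ** ((1 / fact k) *\<^sub>R mpow X k)) sums (K ** mexp X)"
    by (rule bounded_linear.sums[OF mat_mult_bounded_linear_right mexp_sums])
  have "(\<lambda>k. ((1 / fact k) *\<^sub>R mpow X' k) ** K) sums (mexp X' ** K)"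
    by (rule bounded_linear.sums[OF mat_mult_bounded_linear_left mexp_sums])
  then show "(\<lambda>k. K ** ((1 / fact k) *\<^sub>R mpow X k)) sums (mexp X' ** K)"
    by (simp add: mpow_intertwine[OF assms] linear_cmul[OF bounded_linear.linear[OF mat_mult_bounded_linear_right]]
        linear_cmul[OF bounded_linear.linear[OF mat_mult_bounded_linear_left]])
qed

lemma mexp_zero: "mexp 0 = mat 1"
proof (rule sums_unique2[OF mexp_sums])
  have "mpow (0::'a cmat) k = 0" if "k \<noteq> 0" for k
    using that by (cases k) auto
  then show "(\<lambda>k. (1 / fact k) *\<^sub>R mpow (0::'a cmat) k) sums mat 1"
    using sums_finite[of "{0}" "\<lambda>k. (1 / fact k) *\<^sub>R mpow (0::'a cmat) k"] by simp
qed

text \<open>The Cauchy product of the two series, formed entry by entry so that the factors are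
  absolutely convergent complex series. Both arguments are multiples of the same \<open>B\<close>,
  so the matrix powers merge and the binomial theorem sums the coefficients.\<close>

lemma mexp_add: "mexp ((z + w) *\<^sub>C B) = mexp (z *\<^sub>C B) ** mexp (w *\<^sub>C B)"
  for B :: "'n::finite cmat"
proof -
  define t where "t z k = (1 / fact k) *\<^sub>R mpow (z *\<^sub>C B) k" for z k
  have t: "t z sums mexp (z *\<^sub>C B)" for z
    unfolding t_def by (rule mexp_sums)
  have nth: "(\<lambda>k. t z k $ a $ b) sums (mexp (z *\<^sub>C B) $ a $ b)" for z a b
    using bounded_linear.sums[OF bounded_linear_vec_nth bounded_linear.sums[OF bounded_linear_vec_nth t]] .
  have t_nth: "t z k $ a $ b = z ^ k * mpow B k $ a $ b / fact k" for z k a b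
    by (simp add: t_def mpow_scaleC scaleC_mat_nth scaleR_conv_of_real[where 'a = complex])
  have summable_nth: "summable (\<lambda>k. norm (t z k $ a $ b))" for z a b
  proof (rule summable_comparison_test')
    show "summable (\<lambda>k. norm (t z k))" unfolding t_def by (rule summable_norm_mexp)
    show "norm (norm (t z k $ a $ b)) \<le> norm (t z k)" for k
      using Finite_Cartesian_Product.norm_nth_le[of "t z k" a]
        Finite_Cartesian_Product.norm_nth_le[of "t z k $ a" b] by simp
  qed
  have cauchy: "(\<lambda>n. \<Sum>k\<le>n. \<Sum>c\<in>UNIV. t z k $ a $ c * t w (n - k) $ c $ b) sums
      ((mexp (z *\<^sub>C B) ** mexp (w *\<^sub>C B)) $ a $ b)" for a b
  proof -
    have "(\<lambda>n. \<Sum>c\<in>UNIV. \<Sum>k\<le>n. t z k $ a $ c * t w (n - k) $ c $ b) sums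
      (\<Sum>c\<in>UNIV. (\<Sum>k. t z k $ a $ c) * (\<Sum>k. t w k $ c $ b))"
      by (intro sums_sum Cauchy_product_sums summable_nth)
    then show ?thesis
      by (simp add: sums_unique[OF nth, symmetric] matrix_matrix_mult_def sum.swap[of _ UNIV])
  qed
  have binom: "(\<Sum>k\<le>n. \<Sum>c\<in>UNIV. t z k $ a $ c * t w (n - k) $ c $ b) = t (z + w) n $ a $ b"
    for n a b
  proof -
    \<comment> \<open>The two powers of \<open>B\<close> combine to the n-th one whatever k is, and
      1/(k! (n-k)!) is a binomial coefficient over n!.\<close>
    have *: "(\<Sum>c\<in>UNIV. t z k $ a $ c * t w (n - k) $ c $ b) =
        of_nat (n choose k) * z ^ k * w ^ (n - k) * (mpow B n $ a $ b / fact n)"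
      if "k \<le> n" for k
    proof -
      have "mpow B n $ a $ b = (\<Sum>c\<in>UNIV. mpow B k $ a $ c * mpow B (n - k) $ c $ b)"
        using mpow_add[of k "n - k" B] that by (simp add: matrix_matrix_mult_def)
      then show ?thesis
        using that
        by (simp add: t_nth binomial_fact sum_distrib_left sum_divide_distrib mult_ac)
    qed
    have "(\<Sum>k\<le>n. \<Sum>c\<in>UNIV. t z k $ a $ c * t w (n - k) $ c $ b) =
        (\<Sum>k\<le>n. of_nat (n choose k) * z ^ k * w ^ (n - k) * (mpow B n $ a $ b / fact n))"
      by (rule sum.cong[OF refl *]) simp
    also have "\<dots> = t (z + w) n $ a $ b"
      unfolding sum_distrib_right[symmetric] binomial_ring[symmetric] by (simp add: t_nth)
    finally show ?thesis .
  qed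
  have "mexp ((z + w) *\<^sub>C B) $ a $ b = (mexp (z *\<^sub>C B) ** mexp (w *\<^sub>C B)) $ a $ b" for a b
    using sums_unique2[OF nth cauchy[unfolded binom]] .
  then show ?thesis by (simp add: vec_eq_iff)
qed

section \<open>Holomorphic functions between vector spaces\<close>

lemma cholomorphic_onI:
  assumes "\<And>x. x \<in> S \<Longrightarrow> (f has_derivative D x) (at x)"
    and "\<And>x z v. x \<in> S \<Longrightarrow> D x (z *\<^sub>C v) = z *\<^sub>C D x v"
  shows "cholomorphic_on f S"
  unfolding cholomorphic_on_def complex_linear_def
  using assms has_derivative_linear by blast

lemma cholomorphic_onE:
  assumes "cholomorphic_on f S"
  obtains D where "\<forall>x\<in>S. (f has_derivative D x) (at x)"
    "\<forall>x\<in>S. \<forall>z v. D x (z *\<^sub>C v) = z *\<^sub>C D x v"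
  using assms unfolding cholomorphic_on_def complex_linear_def by metis

lemma cholomorphic_on_subset: "cholomorphic_on f S \<Longrightarrow> T \<subseteq> S \<Longrightarrow> cholomorphic_on f T"
  unfolding cholomorphic_on_def by blast

lemma cholomorphic_on_compose:
  assumes "cholomorphic_on f S" "cholomorphic_on g T" "f ` S \<subseteq> T"
  shows "cholomorphic_on (\<lambda>x. g (f x)) S"
proof -
  obtain D where D: "\<forall>x\<in>S. (f has_derivative D x) (at x)"
    "\<forall>x\<in>S. \<forall>z v. D x (z *\<^sub>C v) = z *\<^sub>C D x v"
    using assms(1) by (rule cholomorphic_onE)
  obtain E where E: "\<forall>x\<in>T. (g has_derivative E x) (at x)"
    "\<forall>x\<in>T. \<forall>z v. E x (z *\<^sub>C v) = z *\<^sub>C E x v"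
    using assms(2) by (rule cholomorphic_onE)
  show ?thesis
  proof (rule cholomorphic_onI[where D = "\<lambda>x v. E (f x) (D x v)"])
    fix x assume x: "x \<in> S"
    then have "f x \<in> T" using assms(3) by blast
    then show "E (f x) (D x (z *\<^sub>C v)) = z *\<^sub>C E (f x) (D x v)" for z v
      by (simp add: D(2) E(2) x)
    show "((\<lambda>x. g (f x)) has_derivative (\<lambda>v. E (f x) (D x v))) (at x)"
      by (rule has_derivative_compose[OF bspec[OF D(1) x] bspec[OF E(1) \<open>f x \<in> T\<close>]])
  qed
qed

lemma cholomorphic_on_Pair:
  assumes "cholomorphic_on f S" "cholomorphic_on g S"
  shows "cholomorphic_on (\<lambda>x. (f x, g x)) S"
proof -
  obtain D where D: "\<forall>x\<in>S. (f has_derivative D x) (at x)"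
    "\<forall>x\<in>S. \<forall>z v. D x (z *\<^sub>C v) = z *\<^sub>C D x v"
    using assms(1) by (rule cholomorphic_onE)
  obtain E where E: "\<forall>x\<in>S. (g has_derivative E x) (at x)"
    "\<forall>x\<in>S. \<forall>z v. E x (z *\<^sub>C v) = z *\<^sub>C E x v"
    using assms(2) by (rule cholomorphic_onE)
  show ?thesis
    by (rule cholomorphic_onI[where D = "\<lambda>x v. (D x v, E x v)"])
       (auto simp: D E scaleC_prod_def intro!: has_derivative_Pair)
qed

lemma cholomorphic_on_bounded_linear:
  "bounded_linear f \<Longrightarrow> (\<And>z v. f (z *\<^sub>C v) = z *\<^sub>C f v) \<Longrightarrow> cholomorphic_on f S"
  by (rule cholomorphic_onI[where D = "\<lambda>_. f"]) (auto intro: bounded_linear_imp_has_derivative)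

lemma cholomorphic_on_ident: "cholomorphic_on (\<lambda>x. x) S"
  by (rule cholomorphic_on_bounded_linear) (auto simp: bounded_linear_ident)

lemma cholomorphic_on_fst: "cholomorphic_on fst S"
  by (rule cholomorphic_on_bounded_linear) (auto simp: bounded_linear_fst scaleC_prod_def)

lemma cholomorphic_on_snd: "cholomorphic_on snd S"
  by (rule cholomorphic_on_bounded_linear) (auto simp: bounded_linear_snd scaleC_prod_def)

lemma cholomorphic_on_vec_nth: "cholomorphic_on (\<lambda>x. x $ i) S"
  by (rule cholomorphic_on_bounded_linear) (auto simp: bounded_linear_vec_nth scaleC_vec_def)

lemma scaleC_zero_right: "z *\<^sub>C (0 :: 'a::complex_fd_space) = 0"
  by (rule linear_0[OF bounded_linear.linear[OF bounded_linear_scaleC]])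

lemma cholomorphic_on_const: "cholomorphic_on (\<lambda>x. c) S"
  by (rule cholomorphic_onI[where D = "\<lambda>_ _. 0"]) (auto simp: scaleC_zero_right)

lemma cholomorphic_on_matrix_mult:
  fixes f g :: "'a::complex_fd_space \<Rightarrow> 'n::finite cmat"
  assumes "cholomorphic_on f S" "cholomorphic_on g S"
  shows "cholomorphic_on (\<lambda>x. f x ** g x) S"
proof -
  obtain D where D: "\<forall>x\<in>S. (f has_derivative D x) (at x)"
    "\<forall>x\<in>S. \<forall>z v. D x (z *\<^sub>C v) = z *\<^sub>C D x v"
    using assms(1) by (rule cholomorphic_onE)
  obtain E where E: "\<forall>x\<in>S. (g has_derivative E x) (at x)"
    "\<forall>x\<in>S. \<forall>z v. E x (z *\<^sub>C v) = z *\<^sub>C E x v"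
    using assms(2) by (rule cholomorphic_onE)
  show ?thesis
    by (rule cholomorphic_onI[where D = "\<lambda>x v. f x ** E x v + D x v ** g x"])
       (auto simp: D E scaleC_mat_mult mat_mult_scaleC scaleC_add_right
         intro!: bounded_bilinear.FDERIV[OF bounded_bilinear_matrix_mult])
qed

lemma cholomorphic_on_scaleC:
  assumes "cholomorphic_on f S" "cholomorphic_on g S"
  shows "cholomorphic_on (\<lambda>x. f x *\<^sub>C g x :: 'a::complex_fd_space) S"
proof -
  have B: "bounded_bilinear (\<lambda>z (x::'a). z *\<^sub>C x)"
  proof
    show "(r *\<^sub>R a) *\<^sub>C b = r *\<^sub>R (a *\<^sub>C b)" for r a and b :: 'a
      by (simp add: scaleC_of_real[symmetric] scaleC_scaleC scaleC_complex_def)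
    show "a *\<^sub>C (r *\<^sub>R b) = r *\<^sub>R (a *\<^sub>C b)" for r a and b :: 'a
      by (rule linear_cmul[OF bounded_linear.linear[OF bounded_linear_scaleC]])
    show "\<exists>K. \<forall>a (b::'a). norm (a *\<^sub>C b) \<le> norm a * norm b * K"
      by (rule exI[of _ 1]) (simp add: norm_scaleC)
  qed (simp_all add: scaleC_add_left scaleC_add_right)
  obtain D where D: "\<forall>x\<in>S. (f has_derivative D x) (at x)"
    "\<forall>x\<in>S. \<forall>z v. D x (z *\<^sub>C v) = z *\<^sub>C D x v"
    using assms(1) by (rule cholomorphic_onE)
  obtain E where E: "\<forall>x\<in>S. (g has_derivative E x) (at x)"
    "\<forall>x\<in>S. \<forall>z v. E x (z *\<^sub>C v) = z *\<^sub>C E x v"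
    using assms(2) by (rule cholomorphic_onE)
  show ?thesis
    by (rule cholomorphic_onI[where D = "\<lambda>x v. f x *\<^sub>C E x v + D x v *\<^sub>C g x"])
       (auto simp: D E scaleC_scaleC scaleC_complex_def scaleC_add_right mult.commute
         intro!: bounded_bilinear.FDERIV[OF B])
qed

text \<open>Term-by-term differentiation of the exponential series on a ball. The sum
  \<open>D X\<close> of the termwise differentials is complex linear because each term is and scalar
  multiplication is continuous.\<close>

lemma cholomorphic_on_mexp: "cholomorphic_on (mexp :: 'n::finite cmat \<Rightarrow> 'n cmat) S"
proof -
  define t where "t X V k = (1 / fact k) *\<^sub>R mpow_deriv X V k" for X V :: "'n cmat" and k
  define D where "D X V = (\<Sum>k. t X V k)" for X V :: "'n cmat"
  \<comment> \<open>One summable majorant serves the whole ball and all increments; this makes the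
    tails of the differentiated series uniformly small.\<close>
  have bound: "\<exists>q. summable q \<and> (\<forall>X V k. norm X \<le> R \<longrightarrow> norm (t X V k) \<le> q k * norm V)" for R
  proof (rule mpow_bounds[of R, where 'n = 'n])
    fix r c
    assume *: "\<And>(X::'n cmat) V k. norm X \<le> R \<Longrightarrow> norm (mpow_deriv X V k) \<le> c * r ^ k * norm V"
    show ?thesis
    proof (intro exI[of _ "\<lambda>k. c * r ^ k / fact k"] conjI allI impI)
      show "norm (t X V k) \<le> c * r ^ k / fact k * norm V" if "norm X \<le> R" for X V k
        using *[OF that, of V k] by (simp add: t_def divide_right_mono)
    qed (rule summable_power_over_fact)
  qed
  have t_sums: "t X V sums D X V" for X V
  proof -
    obtain q where q: "summable q \<and>
        (\<forall>Y V k. norm Y \<le> norm X \<longrightarrow> norm (t Y V k) \<le> q k * norm V)"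
      using bound[of "norm X"] by (rule exE)
    then have "norm (t X V k) \<le> q k * norm V" for k by simp
    then have "summable (t X V)"
      by (rule summable_comparison_test'[OF summable_mult2[OF conjunct1[OF q]]])
    then show ?thesis unfolding D_def by (rule summable_sums)
  qed
  have D_scaleC: "D X (z *\<^sub>C V) = z *\<^sub>C D X V" for X V z
  proof (rule sums_unique2[OF t_sums])
    have "(\<lambda>k. z *\<^sub>C t X V k) sums (z *\<^sub>C D X V)"
      by (rule bounded_linear.sums[OF bounded_linear_scaleC t_sums])
    then show "t X (z *\<^sub>C V) sums (z *\<^sub>C D X V)"
      by (simp add: t_def[abs_def] mpow_deriv_scaleC
          linear_cmul[OF bounded_linear.linear[OF bounded_linear_scaleC]])
  qed
  have "(mexp has_derivative D X) (at X)" for X :: "'n cmat"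
  proof -
    \<comment> \<open>The radius exceeds \<open>norm X\<close>, so \<open>X\<close> is interior to
      the ball and a derivative within the ball is a full derivative.\<close>
    define R where "R = norm X + 1"
    define B where "B = ball (0 :: 'n cmat) R"
    obtain q where qq: "summable q \<and>
        (\<forall>Y V k. norm Y \<le> R \<longrightarrow> norm (t Y V k) \<le> q k * norm V)"
      using bound[of R] by (rule exE)
    note q = conjunct1[OF qq] and q_le = conjunct2[OF qq]
    have t_q: "norm (t Y V k) \<le> q k * norm V" if "Y \<in> B" for Y V k
      using q_le that by (simp add: B_def)
    have tail: "norm ((\<Sum>i<n. t Y V i) - D Y V) \<le> (\<Sum>k. q (k + n)) * norm V" if "Y \<in> B" for Y V n
    proof -
      have "D Y V - (\<Sum>i<n. t Y V i) = (\<Sum>k. t Y V (k + n))"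
        using suminf_minus_initial_segment[OF sums_summable[OF t_sums], of Y V n]
        by (simp add: sums_unique[OF t_sums, symmetric])
      moreover have "norm (\<Sum>k. t Y V (k + n)) \<le> (\<Sum>k. q (k + n) * norm V)"
        by (intro norm_suminf_le summable_mult2 t_q that) (simp add: q summable_iff_shift)
      moreover have "\<dots> = (\<Sum>k. q (k + n)) * norm V"
        by (intro suminf_mult2[symmetric]) (simp add: q summable_iff_shift)
      ultimately show ?thesis by (simp add: norm_minus_commute)
    qed
    \<comment> \<open>This yields only some limit function on the ball; uniqueness of sums
      identifies it with \<open>mexp\<close> afterwards.\<close>
    have "\<exists>g. \<forall>Y\<in>B. (\<lambda>k. (1 / fact k) *\<^sub>R mpow Y k) sums g Y \<and> (g has_derivative D Y) (at Y within B)"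
    proof (rule has_derivative_series[where f' = "\<lambda>k Y V. t Y V k"])
      show "convex B" by (simp add: B_def)
      show "((\<lambda>Y. (1 / fact k) *\<^sub>R mpow Y k) has_derivative (\<lambda>V. t Y V k)) (at Y within B)" for k Y
        unfolding t_def by (intro has_derivative_scaleR_right has_derivative_mpow)
      show "X \<in> B" by (simp add: B_def R_def)
      show "(\<lambda>k. (1 / fact k) *\<^sub>R mpow X k) sums mexp X" by (rule mexp_sums)
      fix e :: real
      assume "e > 0"
      have "(\<lambda>n. \<Sum>k. q (k + n)) \<longlonglongrightarrow> 0"
        by (rule suminf_exist_split2[OF q])
      then have "\<forall>\<^sub>F n in sequentially. (\<Sum>k. q (k + n)) < e"
        using \<open>e > 0\<close> by (rule order_tendstoD)
      then show "\<forall>\<^sub>F n in sequentially. \<forall>Y\<in>B. \<forall>V. norm ((\<Sum>i<n. t Y V i) - D Y V) \<le> e * norm V"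
      proof eventually_elim
        case (elim n)
        then show ?case
          using order_trans[OF tail mult_right_mono[OF less_imp_le[OF elim] norm_ge_zero]] by simp
      qed
    qed
    then obtain g where g: "\<forall>Y\<in>B. (\<lambda>k. (1 / fact k) *\<^sub>R mpow Y k) sums g Y \<and>
        (g has_derivative D Y) (at Y within B)"
      by (rule exE)
    have X: "X \<in> B" and B: "open B" by (simp_all add: B_def R_def)
    have "(g has_derivative D X) (at X)"
      using bspec[OF g X] unfolding at_within_open[OF X B] by (rule conjunct2)
    then show ?thesis
    proof (rule has_derivative_transform_within_open[where s = B])
      show "g Y = mexp Y" if "Y \<in> B" for Y
        by (rule sums_unique2[OF conjunct1[OF bspec[OF g that]] mexp_sums])
    qed (rule B X)+
  qed
  then show ?thesis by (rule cholomorphic_onI[where D = D]) (rule D_scaleC)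
qed

section \<open>Holomorphic maps between manifolds\<close>

lemma cholomorphic_on_cong:
  assumes "cholomorphic_on g S" "open S" "\<And>x. x \<in> S \<Longrightarrow> f x = g x"
  shows "cholomorphic_on f S"
  unfolding cholomorphic_on_def
proof
  fix x assume x: "x \<in> S"
  then obtain D where D: "(g has_derivative D) (at x)" "complex_linear D"
    using assms(1) unfolding cholomorphic_on_def by blast
  have "(f has_derivative D) (at x)"
    by (rule has_derivative_transform_within_open[OF D(1) assms(2) x]) (simp add: assms(3))
  then show "\<exists>D. (f has_derivative D) (at x) \<and> complex_linear D" using D(2) by blast
qed

lemma cholomorphic_on_imp_continuous_on: "cholomorphic_on f S \<Longrightarrow> continuous_on S f"
  unfolding cholomorphic_on_def
  by (meson continuous_at_imp_continuous_on has_derivative_continuous)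

context
  fixes c :: "('m::topological_space, 'e::complex_fd_space) chart"
  assumes c: "is_chart c"
begin

lemma chart_inv_coord: "p \<in> dom_chart c \<Longrightarrow> chart_inv c (coord c p) = p"
  using c unfolding is_chart_def homeomorphism_def by blast

lemma open_dom_chart: "open (dom_chart c)"
  using c unfolding is_chart_def by blast

lemma inj_on_coord: "inj_on (coord c) (dom_chart c)"
  by (rule inj_on_inverseI) (rule chart_inv_coord)

lemma open_coord_image:
  assumes "open U"
  shows "open (coord c ` (dom_chart c \<inter> U))"
proof -
  have "homeomorphism (dom_chart c) (chart_image c) (coord c) (chart_inv c)"
    and "open (chart_image c)"
    using c unfolding is_chart_def by blast+
  moreover have "openin (top_of_set (dom_chart c)) (dom_chart c \<inter> U)"
    using assms by (rule openin_open_Int)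
  ultimately show ?thesis
    by (meson homeomorphism_imp_open_map openin_open_trans)
qed

end

lemma complex_manifold_chart: "complex_manifold M A \<Longrightarrow> c \<in> A \<Longrightarrow> is_chart c"
  unfolding complex_manifold_def by blast

lemma complex_manifold_dom_subset: "complex_manifold M A \<Longrightarrow> c \<in> A \<Longrightarrow> dom_chart c \<subseteq> M"
  unfolding complex_manifold_def by blast

lemma complex_manifold_cover:
  "complex_manifold M A \<Longrightarrow> p \<in> M \<Longrightarrow> \<exists>c\<in>A. p \<in> dom_chart c"
  unfolding complex_manifold_def by blast

lemma complex_manifold_transition:
  "complex_manifold M A \<Longrightarrow> c \<in> A \<Longrightarrow> d \<in> A \<Longrightarrow>
   cholomorphic_on (transition c d) (coord c ` (dom_chart c \<inter> dom_chart d))"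
  unfolding complex_manifold_def by blast

lemma complex_manifold_open: "complex_manifold M A \<Longrightarrow> open M"
  using open_dom_chart unfolding complex_manifold_def by blast

lemma holomorphic_map_in: "holomorphic_map M A N B f \<Longrightarrow> p \<in> M \<Longrightarrow> f p \<in> N"
  unfolding holomorphic_map_def by blast

lemma holomorphic_map_continuous: "holomorphic_map M A N B f \<Longrightarrow> continuous_on M f"
  unfolding holomorphic_map_def by blast

lemma holomorphic_map_local:
  "holomorphic_map M A N B f \<Longrightarrow> c \<in> A \<Longrightarrow> d \<in> B \<Longrightarrow>
   cholomorphic_on (coord d \<circ> f \<circ> chart_inv c) (coord c ` (dom_chart c \<inter> f -` dom_chart d))"
  unfolding holomorphic_map_def by blast

text \<open>Derivatives are taken in the full model space, so holomorphy on the singleton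
  \<open>{coord c p}\<close> means complex differentiability at that point. It is therefore enough
  to find, for each p separately, a function \<open>g\<close> that agrees with the local
  representative near p.\<close>

lemma holomorphic_mapI:
  assumes M: "complex_manifold M A"
    and f: "\<And>p. p \<in> M \<Longrightarrow> f p \<in> N" "continuous_on M f"
    and local: "\<And>c d p. c \<in> A \<Longrightarrow> d \<in> B \<Longrightarrow> p \<in> dom_chart c \<Longrightarrow> f p \<in> dom_chart d \<Longrightarrow>
      \<exists>U g. open U \<and> p \<in> U \<and> cholomorphic_on g {coord c p} \<and>
        (\<forall>q\<in>dom_chart c \<inter> U. coord d (f q) = g (coord c q))"
  shows "holomorphic_map M A N B f"
  unfolding holomorphic_map_def
proof (intro conjI ballI)
  show "f ` M \<subseteq> N" using f(1) by blast
  show "continuous_on M f" by (rule f(2))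
  fix c d assume c: "c \<in> A" and d: "d \<in> B"
  show "cholomorphic_on (coord d \<circ> f \<circ> chart_inv c) (coord c ` (dom_chart c \<inter> f -` dom_chart d))"
    unfolding cholomorphic_on_def
  proof
    note chart = complex_manifold_chart[OF M c]
    fix x assume "x \<in> coord c ` (dom_chart c \<inter> f -` dom_chart d)"
    then obtain p where p: "x = coord c p" "p \<in> dom_chart c" "f p \<in> dom_chart d" by blast
    obtain U g where U: "open U" "p \<in> U"
      and g: "cholomorphic_on g {x}"
      and eq: "\<forall>q\<in>dom_chart c \<inter> U. coord d (f q) = g (coord c q)"
      using local[OF c d p(2,3)] unfolding p(1) by blast
    obtain D where D: "(g has_derivative D) (at x)" "complex_linear D"
      using g unfolding cholomorphic_on_def by blast
    have "(coord d \<circ> f \<circ> chart_inv c has_derivative D) (at x)"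
    proof (rule has_derivative_transform_within_open[OF D(1) open_coord_image[OF chart U(1)]])
      show "x \<in> coord c ` (dom_chart c \<inter> U)" using p U by blast
      show "g y = (coord d \<circ> f \<circ> chart_inv c) y" if "y \<in> coord c ` (dom_chart c \<inter> U)" for y
        using that eq by (auto simp: chart_inv_coord[OF chart])
    qed
    with D(2) show "\<exists>D. (coord d \<circ> f \<circ> chart_inv c has_derivative D) (at x) \<and> complex_linear D"
      by blast
  qed
qed

lemma holomorphic_map_cong:
  assumes M: "complex_manifold M A" and f: "holomorphic_map M A N B f"
    and eq: "\<And>p. p \<in> M \<Longrightarrow> g p = f p"
  shows "holomorphic_map M A N B g"
proof (rule holomorphic_mapI[OF M])
  show "g p \<in> N" if "p \<in> M" for p
    using holomorphic_map_in[OF f that] eq[OF that] by simp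
  show "continuous_on M g"
    using holomorphic_map_continuous[OF f] eq continuous_on_cong by metis
  fix c d p
  assume c: "c \<in> A" and d: "d \<in> B" and p: "p \<in> dom_chart c" "g p \<in> dom_chart d"
  have "p \<in> M" using complex_manifold_dom_subset[OF M c] p(1) by blast
  have "cholomorphic_on (coord d \<circ> f \<circ> chart_inv c) {coord c p}"
    using holomorphic_map_local[OF f c d] by (rule cholomorphic_on_subset)
      (use p eq \<open>p \<in> M\<close> in auto)
  moreover have "coord d (g q) = (coord d \<circ> f \<circ> chart_inv c) (coord c q)" if "q \<in> dom_chart c" for q
    using complex_manifold_dom_subset[OF M c] that
    by (auto simp: chart_inv_coord[OF complex_manifold_chart[OF M c]] eq)
  ultimately show "\<exists>U h. open U \<and> p \<in> U \<and> cholomorphic_on h {coord c p} \<and>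
      (\<forall>q\<in>dom_chart c \<inter> U. coord d (g q) = h (coord c q))"
    by (intro exI[of _ UNIV]) auto
qed

lemma holomorphic_map_compose:
  assumes M: "complex_manifold M A" and N: "complex_manifold N B"
    and f: "holomorphic_map M A N B f" and g: "holomorphic_map N B P C g"
  shows "holomorphic_map M A P C (\<lambda>p. g (f p))"
proof (rule holomorphic_mapI[OF M])
  show "g (f p) \<in> P" if "p \<in> M" for p
    by (rule holomorphic_map_in[OF g holomorphic_map_in[OF f that]])
  show "continuous_on M (\<lambda>p. g (f p))"
    by (rule continuous_on_compose2[OF holomorphic_map_continuous[OF g] holomorphic_map_continuous[OF f]])
       (use holomorphic_map_in[OF f] in blast)
  fix c e p
  assume c: "c \<in> A" and e: "e \<in> C" and p: "p \<in> dom_chart c" "g (f p) \<in> dom_chart e"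
  have pM: "p \<in> M" using complex_manifold_dom_subset[OF M c] p(1) by blast
  \<comment> \<open>The image of \<open>c\<close> need not lie in a single chart of
    \<open>N\<close>, so a chart around \<open>f p\<close> is interposed; by continuity the points
    that \<open>f\<close> sends into it form a neighbourhood of \<open>p\<close>.\<close>
  obtain d where d: "d \<in> B" "f p \<in> dom_chart d"
    using complex_manifold_cover[OF N holomorphic_map_in[OF f pM]] by blast
  note cc = complex_manifold_chart[OF M c] and cd = complex_manifold_chart[OF N d(1)]
  define h where "h = (\<lambda>x. (coord e \<circ> g \<circ> chart_inv d) ((coord d \<circ> f \<circ> chart_inv c) x))"
  have "cholomorphic_on h {coord c p}"
    unfolding h_def
  proof (rule cholomorphic_on_compose[where T = "{coord d (f p)}"])
    show "cholomorphic_on (coord d \<circ> f \<circ> chart_inv c) {coord c p}"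
      using holomorphic_map_local[OF f c d(1)] by (rule cholomorphic_on_subset) (use p d in auto)
    show "cholomorphic_on (coord e \<circ> g \<circ> chart_inv d) {coord d (f p)}"
      using holomorphic_map_local[OF g d(1) e] by (rule cholomorphic_on_subset) (use p d in auto)
  qed (simp add: chart_inv_coord[OF cc p(1)])
  moreover have "open (M \<inter> f -` dom_chart d)"
    by (rule continuous_open_preimage[OF holomorphic_map_continuous[OF f]
          complex_manifold_open[OF M] open_dom_chart[OF cd]])
  moreover have "coord e (g (f q)) = h (coord c q)"
    if "q \<in> dom_chart c \<inter> (M \<inter> f -` dom_chart d)" for q
    using that by (simp add: h_def chart_inv_coord[OF cc] chart_inv_coord[OF cd])
  ultimately show "\<exists>U h. open U \<and> p \<in> U \<and> cholomorphic_on h {coord c p} \<and>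
      (\<forall>q\<in>dom_chart c \<inter> U. coord e (g (f q)) = h (coord c q))"
    using pM d(2) by (intro exI[of _ "M \<inter> f -` dom_chart d"] exI[of _ h]) auto
qed

section \<open>Products of manifolds\<close>

lemma prod_atlasE:
  assumes "c \<in> prod_atlas A B"
  obtains c1 c2 where "c1 \<in> A" "c2 \<in> B" "dom_chart c = dom_chart c1 \<times> dom_chart c2"
    "coord c = map_prod (coord c1) (coord c2)"
  using assms unfolding prod_atlas_def by auto

lemma chart_image_prod:
  "chart_image (dom_chart c \<times> dom_chart d, map_prod (coord c) (coord d)) = chart_image c \<times> chart_image d"
  by (auto simp: chart_image_def)

text \<open>\<open>chart_inv\<close> is a choice-based inverse, so for the product chart it is tied
  to the factors only on the image, where injectivity determines it.\<close>

lemma chart_inv_prod: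
  assumes c: "is_chart c" and d: "is_chart d"
    and xy: "xy \<in> chart_image c \<times> chart_image d"
  shows "chart_inv (dom_chart c \<times> dom_chart d, map_prod (coord c) (coord d)) xy =
    map_prod (chart_inv c) (chart_inv d) xy"
proof -
  have inj: "inj_on (map_prod (coord c) (coord d)) (dom_chart c \<times> dom_chart d)"
    by (rule map_prod_inj_on[OF inj_on_coord[OF c] inj_on_coord[OF d]])
  obtain p q where "p \<in> dom_chart c" "q \<in> dom_chart d" "xy = (coord c p, coord d q)"
    using xy by (auto simp: chart_image_def)
  then show ?thesis
    using inv_into_f_f[OF inj, of "(p, q)"]
    by (simp add: chart_inv_def[of "(_, _)"] chart_inv_coord[OF c] chart_inv_coord[OF d])
qed

lemma continuous_on_map_prod:
  assumes "continuous_on S f" "continuous_on T g"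
  shows "continuous_on (S \<times> T) (map_prod f g)"
  unfolding map_prod_def case_prod_unfold
  by (intro continuous_on_Pair continuous_on_compose2[OF assms(1) continuous_on_fst[OF continuous_on_id]]
      continuous_on_compose2[OF assms(2) continuous_on_snd[OF continuous_on_id]]) auto

lemma is_chart_prod:
  assumes c: "is_chart c" and d: "is_chart d"
  shows "is_chart (dom_chart c \<times> dom_chart d, map_prod (coord c) (coord d))"
proof -
  let ?e = "(dom_chart c \<times> dom_chart d, map_prod (coord c) (coord d))"
  have hc: "homeomorphism (dom_chart c) (chart_image c) (coord c) (chart_inv c)"
    and hd: "homeomorphism (dom_chart d) (chart_image d) (coord d) (chart_inv d)"
    using c d unfolding is_chart_def by blast+
  have "homeomorphism (dom_chart ?e) (chart_image ?e) (coord ?e) (map_prod (chart_inv c) (chart_inv d))"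
    unfolding chart_image_prod fst_conv snd_conv
    by (rule homeomorphismI)
       (use hc hd in \<open>auto simp: homeomorphism_def intro!: continuous_on_map_prod\<close>)
  then have "homeomorphism (dom_chart ?e) (chart_image ?e) (coord ?e) (chart_inv ?e)"
    by (rule homeomorphism_cong) (simp_all add: chart_image_prod chart_inv_prod[OF c d])
  then show ?thesis
    using c d unfolding is_chart_def chart_image_prod by (auto intro: open_Times)
qed

lemma holomorphic_map_Pair:
  assumes f: "holomorphic_map M A N B f" and g: "holomorphic_map M A P C g"
  shows "holomorphic_map M A (N \<times> P) (prod_atlas B C) (\<lambda>p. (f p, g p))"
  unfolding holomorphic_map_def
proof (intro conjI ballI)
  show "(\<lambda>p. (f p, g p)) ` M \<subseteq> N \<times> P"
    using holomorphic_map_in[OF f] holomorphic_map_in[OF g] by blast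
  show "continuous_on M (\<lambda>p. (f p, g p))"
    by (intro continuous_on_Pair holomorphic_map_continuous[OF f] holomorphic_map_continuous[OF g])
  fix c e
  assume c: "c \<in> A" and "e \<in> prod_atlas B C"
  then obtain d1 d2 where d: "d1 \<in> B" "d2 \<in> C" "dom_chart e = dom_chart d1 \<times> dom_chart d2"
    "coord e = map_prod (coord d1) (coord d2)"
    by (elim prod_atlasE)
  have eq: "coord e \<circ> (\<lambda>p. (f p, g p)) \<circ> chart_inv c =
      (\<lambda>x. ((coord d1 \<circ> f \<circ> chart_inv c) x, (coord d2 \<circ> g \<circ> chart_inv c) x))"
    by (simp add: d fun_eq_iff)
  show "cholomorphic_on (coord e \<circ> (\<lambda>p. (f p, g p)) \<circ> chart_inv c)
      (coord c ` (dom_chart c \<inter> (\<lambda>p. (f p, g p)) -` dom_chart e))"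
    unfolding eq
    by (intro cholomorphic_on_Pair cholomorphic_on_subset[OF holomorphic_map_local[OF f c d(1)]]
        cholomorphic_on_subset[OF holomorphic_map_local[OF g c d(2)]])
       (auto simp: d)
qed

lemma complex_manifold_prod:
  assumes M: "complex_manifold M A" and N: "complex_manifold N B"
  shows "complex_manifold (M \<times> N) (prod_atlas A B)"
  unfolding complex_manifold_def
proof (intro conjI ballI)
  show "is_chart c" if "c \<in> prod_atlas A B" for c
    using that unfolding prod_atlas_def
    by (blast intro: is_chart_prod complex_manifold_chart[OF M] complex_manifold_chart[OF N])
  show "(\<Union>c\<in>prod_atlas A B. dom_chart c) = M \<times> N"
  proof -
    have "(\<Union>c\<in>prod_atlas A B. dom_chart c) = (\<Union>c\<in>A. dom_chart c) \<times> (\<Union>d\<in>B. dom_chart d)"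
      by (auto simp: prod_atlas_def) blast
    then show ?thesis using M N by (simp add: complex_manifold_def)
  qed
  fix c d
  assume "c \<in> prod_atlas A B" "d \<in> prod_atlas A B"
  then obtain c1 c2 d1 d2 where cA: "c1 \<in> A" "d1 \<in> A" and cB: "c2 \<in> B" "d2 \<in> B"
    and c: "c = (dom_chart c1 \<times> dom_chart c2, map_prod (coord c1) (coord c2))"
    and d: "d = (dom_chart d1 \<times> dom_chart d2, map_prod (coord d1) (coord d2))"
    unfolding prod_atlas_def by blast
  note c1 = complex_manifold_chart[OF M cA(1)] and c2 = complex_manifold_chart[OF N cB(1)]
  note d1 = complex_manifold_chart[OF M cA(2)] and d2 = complex_manifold_chart[OF N cB(2)]
  let ?S1 = "coord c1 ` (dom_chart c1 \<inter> dom_chart d1)"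
  let ?S2 = "coord c2 ` (dom_chart c2 \<inter> dom_chart d2)"
  have S: "coord c ` (dom_chart c \<inter> dom_chart d) = ?S1 \<times> ?S2"
    by (auto simp: c d)
  have "cholomorphic_on (\<lambda>x. (transition c1 d1 (fst x), transition c2 d2 (snd x))) (?S1 \<times> ?S2)"
    by (intro cholomorphic_on_Pair
        cholomorphic_on_compose[OF cholomorphic_on_fst complex_manifold_transition[OF M cA]]
        cholomorphic_on_compose[OF cholomorphic_on_snd complex_manifold_transition[OF N cB]]) auto
  then show "cholomorphic_on (transition c d) (coord c ` (dom_chart c \<inter> dom_chart d))"
    unfolding S
  proof (rule cholomorphic_on_cong)
    show "open (?S1 \<times> ?S2)"
      by (intro open_Times open_coord_image c1 c2 open_dom_chart d1 d2)
    fix x assume "x \<in> ?S1 \<times> ?S2"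
    then have "x \<in> chart_image c1 \<times> chart_image c2"
      by (auto simp: chart_image_def)
    then show "transition c d x = (transition c1 d1 (fst x), transition c2 d2 (snd x))"
      using chart_inv_prod[OF c1 c2]
      by (simp add: transition_def c d map_prod_def case_prod_unfold)
  qed
qed

text \<open>In charts the projection is the linear projection followed by a transition map, because
  the target chart need not be the factor of the product chart.\<close>

lemma holomorphic_map_fst:
  assumes M: "complex_manifold M A" and N: "complex_manifold N B"
  shows "holomorphic_map (M \<times> N) (prod_atlas A B) M A fst"
proof (rule holomorphic_mapI[OF complex_manifold_prod[OF M N]])
  show "continuous_on (M \<times> N) fst" by (intro continuous_intros)
  fix c d p
  assume c: "c \<in> prod_atlas A B" and d: "d \<in> A" and p: "p \<in> dom_chart c" "fst p \<in> dom_chart d"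
  obtain c1 c2 where c12: "c1 \<in> A" "c2 \<in> B" "dom_chart c = dom_chart c1 \<times> dom_chart c2"
    "coord c = map_prod (coord c1) (coord c2)"
    using c by (rule prod_atlasE)
  have "cholomorphic_on (\<lambda>x. transition c1 d (fst x)) {coord c p}"
    by (rule cholomorphic_on_compose[OF cholomorphic_on_fst complex_manifold_transition[OF M c12(1) d]])
       (use p in \<open>auto simp: c12\<close>)
  moreover have "coord d (fst q) = transition c1 d (fst (coord c q))" if "q \<in> dom_chart c" for q
    using that chart_inv_coord[OF complex_manifold_chart[OF M c12(1)]]
    by (auto simp: c12 transition_def)
  ultimately show "\<exists>U g. open U \<and> p \<in> U \<and> cholomorphic_on g {coord c p} \<and>
      (\<forall>q\<in>dom_chart c \<inter> U. coord d (fst q) = g (coord c q))"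
    by (intro exI[of _ UNIV] exI[of _ "\<lambda>x. transition c1 d (fst x)"]) auto
qed auto

lemma holomorphic_map_snd:
  assumes M: "complex_manifold M A" and N: "complex_manifold N B"
  shows "holomorphic_map (M \<times> N) (prod_atlas A B) N B snd"
proof (rule holomorphic_mapI[OF complex_manifold_prod[OF M N]])
  show "continuous_on (M \<times> N) snd" by (intro continuous_intros)
  fix c d p
  assume c: "c \<in> prod_atlas A B" and d: "d \<in> B" and p: "p \<in> dom_chart c" "snd p \<in> dom_chart d"
  obtain c1 c2 where c12: "c1 \<in> A" "c2 \<in> B" "dom_chart c = dom_chart c1 \<times> dom_chart c2"
    "coord c = map_prod (coord c1) (coord c2)"
    using c by (rule prod_atlasE)
  have "cholomorphic_on (\<lambda>x. transition c2 d (snd x)) {coord c p}"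
    by (rule cholomorphic_on_compose[OF cholomorphic_on_snd complex_manifold_transition[OF N c12(2) d]])
       (use p in \<open>auto simp: c12\<close>)
  moreover have "coord d (snd q) = transition c2 d (snd (coord c q))" if "q \<in> dom_chart c" for q
    using that chart_inv_coord[OF complex_manifold_chart[OF N c12(2)]]
    by (auto simp: c12 transition_def)
  ultimately show "\<exists>U g. open U \<and> p \<in> U \<and> cholomorphic_on g {coord c p} \<and>
      (\<forall>q\<in>dom_chart c \<inter> U. coord d (snd q) = g (coord c q))"
    by (intro exI[of _ UNIV] exI[of _ "\<lambda>x. transition c2 d (snd x)"]) auto
qed auto

section \<open>Open subsets of vector spaces as manifolds\<close>

lemma chart_inv_open_atlas: "x \<in> S \<Longrightarrow> chart_inv (S, \<lambda>x. x) x = x"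
  using inv_into_f_f[of "\<lambda>x. x" S x] by (simp add: chart_inv_def)

lemma chart_image_open_atlas: "chart_image (S, \<lambda>x. x) = S"
  by (simp add: chart_image_def)

lemma complex_manifold_open_atlas:
  fixes S :: "'a::{complex_fd_space, second_countable_topology} set"
  assumes "open S"
  shows "complex_manifold S (open_atlas S)"
proof -
  have "homeomorphism S S (\<lambda>x. x) (\<lambda>x. x)"
    by (auto simp: homeomorphism_def)
  then have "homeomorphism S S (\<lambda>x. x) (chart_inv (S, \<lambda>x. x))"
    by (rule homeomorphism_cong) (simp_all add: chart_inv_open_atlas)
  moreover have "cholomorphic_on (transition (S, \<lambda>x. x) (S, \<lambda>x. x)) S"
    by (rule cholomorphic_on_cong[OF cholomorphic_on_ident assms])
       (simp add: transition_def chart_inv_open_atlas)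
  ultimately show ?thesis
    using assms
    by (simp add: complex_manifold_def open_atlas_def is_chart_def chart_image_open_atlas)
qed

text \<open>Both atlases consist of one chart, so the equality is literal. It lets maps out of C x
  gl(n) be treated as functions on one vector space.\<close>

lemma prod_open_atlas: "prod_atlas (open_atlas S) (open_atlas T) = open_atlas (S \<times> T)"
  by (simp add: prod_atlas_def open_atlas_def map_prod_def id_def)

lemma cholomorphic_on_imp_holomorphic_map:
  fixes f :: "'a::{complex_fd_space, second_countable_topology} \<Rightarrow> 'b::complex_fd_space"
  assumes f: "cholomorphic_on f S" and S: "open S" and "f ` S \<subseteq> T"
  shows "holomorphic_map S (open_atlas S) T (open_atlas T) f"
proof (rule holomorphic_mapI[OF complex_manifold_open_atlas[OF S]])
  show "continuous_on S f" by (rule cholomorphic_on_imp_continuous_on[OF f])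
  fix c d p
  assume "c \<in> open_atlas S" "d \<in> open_atlas T" "p \<in> dom_chart c"
  then show "\<exists>U g. open U \<and> p \<in> U \<and> cholomorphic_on g {coord c p} \<and>
      (\<forall>q\<in>dom_chart c \<inter> U. coord d (f q) = g (coord c q))"
    using f cholomorphic_on_subset[OF f, of "{p}"]
    by (intro exI[of _ UNIV] exI[of _ f]) (simp add: open_atlas_def)
qed (use assms in blast)

section \<open>Actions of vector spaces\<close>

text \<open>A group action is a homomorphism into \<open>BijGroup M\<close>, whose elements are
  extensional bijections of \<open>M\<close>. Bijectivity follows from the action laws, with
  \<open>\<phi> (- v)\<close> as the inverse of \<open>\<phi> v\<close>, which leaves conditions
  that can be checked pointwise.\<close>

lemma vector_space_action_iff:
  fixes \<phi> :: "'v::complex_fd_space \<Rightarrow> 'm::topological_space \<Rightarrow> 'm"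
  shows "vector_space_action M A \<phi> \<longleftrightarrow>
    (\<forall>v. \<phi> v \<in> extensional M) \<and> (\<forall>v. \<forall>p\<in>M. \<phi> v p \<in> M) \<and> (\<forall>p\<in>M. \<phi> 0 p = p) \<and>
    (\<forall>v w. \<forall>p\<in>M. \<phi> (v + w) p = \<phi> v (\<phi> w p)) \<and>
    holomorphic_map (UNIV \<times> M) (prod_atlas (open_atlas UNIV) A) M A (\<lambda>(v, p). \<phi> v p)"
    (is "_ \<longleftrightarrow> ?ext \<and> ?closed \<and> ?zero \<and> ?add \<and> ?hol")
proof -
  let ?G = "additive_group :: 'v monoid"
  have G: "group ?G"
  proof (rule groupI)
    show "\<exists>y\<in>carrier ?G. y \<otimes>\<^bsub>?G\<^esub> x = \<one>\<^bsub>?G\<^esub>" for x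
      by (rule bexI[of _ "- x"]) (simp_all add: additive_group_def)
  qed (simp_all add: additive_group_def add.assoc)
  have "group_action ?G M \<phi> \<longleftrightarrow> ?ext \<and> ?closed \<and> ?zero \<and> ?add"
  proof
    assume "group_action ?G M \<phi>"
    then interpret group_action ?G M \<phi> .
    have Bij: "\<phi> v \<in> Bij M" for v
      using bij_prop0[of v] by (simp add: additive_group_def)
    have "\<phi> 0 p = p" if "p \<in> M" for p
      using id_eq_one that by (metis additive_group_def monoid.select_convs(2) restrict_apply)
    moreover have "\<phi> (v + w) p = \<phi> v (\<phi> w p)" if "p \<in> M" for v w p
      using composition_rule[OF that, of v w] by (simp add: additive_group_def)
    moreover have "\<phi> v p \<in> M" if "p \<in> M" for v p
      using bij_betw_apply[of "\<phi> v" M M p] Bij[of v] that by (simp add: Bij_def)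
    ultimately show "?ext \<and> ?closed \<and> ?zero \<and> ?add"
      using Bij by (simp add: Bij_def)
  next
    assume *: "?ext \<and> ?closed \<and> ?zero \<and> ?add"
    have inv: "\<phi> (- v) (\<phi> v p) = p" "\<phi> v (\<phi> (- v) p) = p" if "p \<in> M" for v p
      using * that by (metis add.left_inverse, metis add.right_inverse)
    have Bij: "\<phi> v \<in> Bij M" for v
      using * inv by (auto simp: Bij_def intro!: bij_betw_byWitness[where f' = "\<phi> (- v)"])
    have "\<phi> (v + w) = compose M (\<phi> v) (\<phi> w)" for v w
      using * by (intro extensionalityI[of _ M]) (auto simp: compose_eq)
    then have "\<phi> \<in> hom ?G (BijGroup M)"
      using Bij by (auto simp: hom_def additive_group_def BijGroup_def)
    then show "group_action ?G M \<phi>"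
      unfolding group_action_def group_hom_def group_hom_axioms_def
      using G group_BijGroup by blast
  qed
  then show ?thesis
    by (simp add: vector_space_action_def holomorphic_action_def additive_group_def)
qed

lemma vector_space_actionD:
  assumes "vector_space_action M A \<phi>"
  shows "\<phi> v \<in> extensional M" "p \<in> M \<Longrightarrow> \<phi> v p \<in> M" "p \<in> M \<Longrightarrow> \<phi> 0 p = p"
    "p \<in> M \<Longrightarrow> \<phi> (v + w) p = \<phi> v (\<phi> w p)"
    "holomorphic_map (UNIV \<times> M) (prod_atlas (open_atlas UNIV) A) M A (\<lambda>(v, p). \<phi> v p)"
  using assms unfolding vector_space_action_iff by blast+

section \<open>Assembling commuting actions of C\<close>

primrec joint_action ::
    "'m set \<Rightarrow> ('i::finite \<Rightarrow> complex \<Rightarrow> 'm \<Rightarrow> 'm) \<Rightarrow> 'i list \<Rightarrow> complex ^ 'i \<Rightarrow> 'm \<Rightarrow> 'm"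
  where "joint_action M \<phi> [] v = (\<lambda>p\<in>M. p)"
  | "joint_action M \<phi> (i # xs) v = (\<lambda>p\<in>M. \<phi> i (v $ i) (joint_action M \<phi> xs v p))"

text \<open>The index type of the family becomes the coordinate type of the acting vector
  space.\<close>

locale commuting_actions =
  fixes M :: "'m::{t2_space, second_countable_topology} set"
    and A :: "('m, 'e::complex_fd_space) chart set"
    and \<phi> :: "'i::finite \<Rightarrow> complex \<Rightarrow> 'm \<Rightarrow> 'm"
  assumes manifold: "complex_manifold M A"
    and action: "vector_space_action M A (\<phi> i)"
    and commute: "p \<in> M \<Longrightarrow> \<phi> i z (\<phi> j w p) = \<phi> j w (\<phi> i z p)"
begin

text \<open>Both claims share one induction, because moving an action past the next factor needs the
  partial composite to stay in \<open>M\<close>.\<close>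

lemma joint_action_commute:
  "p \<in> M \<Longrightarrow> joint_action M \<phi> xs v p \<in> M \<and>
    \<phi> i z (joint_action M \<phi> xs v p) = joint_action M \<phi> xs v (\<phi> i z p)"
proof (induction xs)
  case Nil
  then show ?case using vector_space_actionD(2)[OF action] by simp
next
  case (Cons j xs)
  then show ?case
    using vector_space_actionD(2)[OF action] commute[of "joint_action M \<phi> xs v p" i z j "v $ j"]
    by simp
qed

text \<open>A further index pairs the coordinate \<open>v $ i\<close> with the previous composite
  and feeds the pair to \<open>\<phi> i\<close>, which is holomorphic in both arguments
  jointly.\<close>

lemma holomorphic_joint_action:
  "holomorphic_map (UNIV \<times> M) (prod_atlas (open_atlas UNIV) A) M A
    (\<lambda>(v, p). joint_action M \<phi> xs v p)"
proof -
  have V: "complex_manifold (UNIV :: (complex ^ 'i) set) (open_atlas UNIV)"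
    and C: "complex_manifold (UNIV :: complex set) (open_atlas UNIV)"
    by (rule complex_manifold_open_atlas[OF open_UNIV])+
  note VM = complex_manifold_prod[OF V manifold] and CM = complex_manifold_prod[OF C manifold]
  show ?thesis
  proof (induction xs)
    case Nil
    show ?case
      by (rule holomorphic_map_cong[OF VM holomorphic_map_snd[OF V manifold]]) auto
  next
    case (Cons i xs)
    have nth: "holomorphic_map UNIV (open_atlas UNIV) UNIV (open_atlas UNIV) (\<lambda>v :: complex ^ 'i. v $ i)"
      by (rule cholomorphic_on_imp_holomorphic_map[OF cholomorphic_on_vec_nth]) auto
    have "holomorphic_map (UNIV \<times> M) (prod_atlas (open_atlas UNIV) A)
        (UNIV \<times> M) (prod_atlas (open_atlas UNIV) A)
        (\<lambda>x. (fst x $ i, (\<lambda>(v, p). joint_action M \<phi> xs v p) x))"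
      by (rule holomorphic_map_Pair[OF
            holomorphic_map_compose[OF VM V holomorphic_map_fst[OF V manifold] nth] Cons])
    then have "holomorphic_map (UNIV \<times> M) (prod_atlas (open_atlas UNIV) A) M A
        (\<lambda>x. (\<lambda>(z, p). \<phi> i z p) (fst x $ i, (\<lambda>(v, p). joint_action M \<phi> xs v p) x))"
      by (rule holomorphic_map_compose[OF VM CM _ vector_space_actionD(5)[OF action]])
    then show ?case
      by (rule holomorphic_map_cong[OF VM]) auto
  qed
qed

lemma vector_space_action_joint_action: "vector_space_action M A (joint_action M \<phi> xs)"
proof -
  note closed = conjunct1[OF joint_action_commute] and comm = conjunct2[OF joint_action_commute]
  have ext: "joint_action M \<phi> xs v \<in> extensional M" for v
    by (cases xs) simp_all
  have zero: "joint_action M \<phi> xs 0 p = p" if "p \<in> M" for p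
    using that by (induction xs) (simp_all add: vector_space_actionD(3)[OF action])
  have add: "joint_action M \<phi> xs (v + w) p = joint_action M \<phi> xs v (joint_action M \<phi> xs w p)"
    if "p \<in> M" for v w p
    using that
  proof (induction xs)
    case (Cons i xs)
    let ?J = "joint_action M \<phi> xs"
    have "\<phi> i (v $ i + w $ i) (?J (v + w) p) = \<phi> i (v $ i) (\<phi> i (w $ i) (?J v (?J w p)))"
      using Cons by (simp add: vector_space_actionD(4)[OF action] closed)
    \<comment> \<open>The factor with parameter \<open>w $ i\<close> has to move inside
      \<open>?J v\<close> to meet \<open>?J w\<close>.\<close>
    also have "\<dots> = \<phi> i (v $ i) (?J v (\<phi> i (w $ i) (?J w p)))"
      using Cons.prems by (simp add: comm closed)
    finally show ?case
      using Cons.prems by (simp add: closed vector_space_actionD(2)[OF action])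
  qed simp
  show ?thesis
    unfolding vector_space_action_iff
    using ext closed zero add holomorphic_joint_action by blast
qed

text \<open>On an axis every other factor has parameter 0 and is the identity; distinctness keeps
  the factor of \<open>i\<close> from acting twice.\<close>

lemma joint_action_axis:
  assumes "distinct xs" "p \<in> M"
  shows "joint_action M \<phi> xs (axis i z) p = (if i \<in> set xs then \<phi> i z p else p)"
  using assms
  by (induction xs) (auto simp: vector_space_actionD(2,3)[OF action] axis_def)

text \<open>The source of uniqueness: a vector is the sum of its axis components, where
  \<open>\<rho>\<close> is prescribed, and additivity turns this sum into the composite in the order
  of the list.\<close>

lemma action_eq_joint_action:
  assumes \<rho>: "vector_space_action M A \<rho>" "\<And>i z. \<rho> (axis i z) = \<phi> i z"
    and "distinct xs" "p \<in> M"
  shows "\<rho> (\<Sum>i\<in>set xs. axis i (v $ i)) p = joint_action M \<phi> xs v p"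
  using assms(3)
proof (induction xs)
  case Nil
  then show ?case using \<open>p \<in> M\<close> by (simp add: vector_space_actionD(3)[OF \<rho>(1)])
next
  case (Cons i xs)
  then show ?case using \<open>p \<in> M\<close> by (simp add: vector_space_actionD(4)[OF \<rho>(1)] \<rho>(2))
qed

lemma ex1_joint_action:
  "\<exists>!\<rho> :: complex ^ 'i \<Rightarrow> 'm \<Rightarrow> 'm.
    vector_space_action M A \<rho> \<and> (\<forall>i z. \<rho> (axis i z) = \<phi> i z)"
proof -
  obtain xs :: "'i list" where xs: "set xs = UNIV" "distinct xs"
    using finite_distinct_list[OF finite] by blast
  show ?thesis
  proof (rule ex1I[of _ "joint_action M \<phi> xs"])
    have "joint_action M \<phi> xs (axis i z) = \<phi> i z" for i z
      by (rule extensionalityI[of _ M])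
        (simp_all add: vector_space_actionD(1)[OF vector_space_action_joint_action]
          vector_space_actionD(1)[OF action] joint_action_axis xs)
    then show "vector_space_action M A (joint_action M \<phi> xs) \<and>
        (\<forall>i z. joint_action M \<phi> xs (axis i z) = \<phi> i z)"
      using vector_space_action_joint_action by blast
  next
    fix \<rho> :: "complex ^ 'i \<Rightarrow> 'm \<Rightarrow> 'm"
    assume \<rho>: "vector_space_action M A \<rho> \<and> (\<forall>i z. \<rho> (axis i z) = \<phi> i z)"
    have "\<rho> v p = joint_action M \<phi> xs v p" if "p \<in> M" for v p
    proof -
      have "(\<Sum>i\<in>set xs. axis i (v $ i)) = v"
        by (simp add: xs vec_eq_iff axis_def)
      then show ?thesis
        using action_eq_joint_action[of \<rho> xs p v] \<rho> xs that by simp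
    qed
    \<comment> \<open>Both sides are extensional, so agreement on \<open>M\<close> is equality of
      functions.\<close>
    then have "\<rho> v = joint_action M \<phi> xs v" for v
      by (rule extensionalityI[OF vector_space_actionD(1)[OF conjunct1[OF \<rho>]]
            vector_space_actionD(1)[OF vector_space_action_joint_action]])
    then show "\<rho> = joint_action M \<phi> xs" by (rule ext)
  qed
qed

end

section \<open>Blocks and their powers\<close>

lemma upper_block_one_mult:
  "upper_block m (mat 1) ** X = (\<chi> a b. if pos a \<le> m then X $ a $ b else 0)"
  for X :: "'n::{finite, linorder} cmat"
proof -
  have "(\<Sum>k\<in>UNIV. (if pos a \<le> m \<and> pos k \<le> m then (mat 1 :: 'n cmat) $ a $ k else 0) * X $ k $ b) =
      (\<Sum>k\<in>UNIV. if a = k then if pos a \<le> m then X $ k $ b else 0 else 0)" for a b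
    by (rule sum.cong) (auto simp: mat_def)
  then show ?thesis by (simp add: vec_eq_iff upper_block_def matrix_matrix_mult_def)
qed

lemma mult_upper_block_one:
  "X ** upper_block m (mat 1) = (\<chi> a b. if pos b \<le> m then X $ a $ b else 0)"
  for X :: "'n::{finite, linorder} cmat"
proof -
  have "(\<Sum>k\<in>UNIV. X $ a $ k * (if pos k \<le> m \<and> pos b \<le> m then (mat 1 :: 'n cmat) $ k $ b else 0)) =
      (\<Sum>k\<in>UNIV. if k = b then if pos b \<le> m then X $ a $ k else 0 else 0)" for a b
    by (rule sum.cong) (auto simp: mat_def)
  then show ?thesis by (simp add: vec_eq_iff upper_block_def matrix_matrix_mult_def)
qed

text \<open>With a block written as a product, commutation with the projector controls it, and its
  holomorphy is that of a matrix product.\<close>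

lemma upper_block_eq: "upper_block m X = upper_block m (mat 1) ** X ** upper_block m (mat 1)"
  unfolding upper_block_one_mult mult_upper_block_one
  by (simp add: upper_block_def vec_eq_iff)

lemma upper_block_one_idem:
  "l \<le> m \<Longrightarrow> upper_block m (mat 1) ** upper_block l (mat 1) = upper_block l (mat 1 :: 'n::{finite, linorder} cmat)"
  "l \<le> m \<Longrightarrow> upper_block l (mat 1) ** upper_block m (mat 1) = upper_block l (mat 1 :: 'n::{finite, linorder} cmat)"
  unfolding upper_block_one_mult by (auto simp: vec_eq_iff upper_block_def mat_def)

lemma upper_block_upper_block: "l \<le> m \<Longrightarrow> upper_block l (upper_block m X) = upper_block l X"
  by (auto simp: upper_block_def vec_eq_iff)

text \<open>gl(l) lies in gl(m), whose unit is the projector of size m. The zeroth power is included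
  because it is the unit of gl(l); the full identity matrix would violate the claim when m <
  n.\<close>

lemma upper_block_one_block_power:
  assumes "l \<le> m"
  shows "upper_block m (mat 1) ** block_power l k X = block_power l k X"
    and "block_power l k X ** upper_block m (mat 1) = block_power l k X"
proof -
  have Y: "upper_block m (mat 1) ** upper_block l X = upper_block l X"
    unfolding upper_block_eq[of l X] by (simp add: matrix_mul_assoc upper_block_one_idem[OF assms])
  show "upper_block m (mat 1) ** block_power l k X = block_power l k X"
    unfolding block_power_def
    by (cases k) (simp_all add: upper_block_one_idem[OF assms] matrix_mul_assoc Y)
  show "block_power l k X ** upper_block m (mat 1) = block_power l k X"
    unfolding block_power_def
    \<comment> \<open>The rightmost factor of every block power is the projector of size l, so the
      right-hand multiplication is resolved in the base case.\<close>
    by (induction k) (simp_all add: upper_block_one_idem[OF assms] matrix_mul_assoc[symmetric])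
qed

text \<open>The second assumption settles the zeroth power, where a projector stands in place of the
  identity matrix.\<close>

lemma block_power_intertwine:
  assumes "K ** upper_block m X = upper_block m X' ** K"
    and "K ** upper_block m (mat 1) = upper_block m (mat 1) ** K"
  shows "K ** block_power m k X = block_power m k X' ** K"
proof (induction k)
  case 0
  show ?case by (simp add: block_power_def assms(2))
next
  case (Suc k)
  have "K ** block_power m (Suc k) X = (K ** upper_block m X) ** block_power m k X"
    by (simp add: block_power_def matrix_mul_assoc)
  also have "\<dots> = upper_block m X' ** (K ** block_power m k X)"
    by (simp add: assms(1) matrix_mul_assoc)
  also have "\<dots> = block_power m (Suc k) X' ** K"
    unfolding Suc by (simp add: block_power_def matrix_mul_assoc)
  finally show ?case .
qed

lemma upper_block_mult_block_power:
  "upper_block m X ** block_power m k X = block_power m k X ** upper_block m X"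
proof (rule block_power_intertwine)
  show "upper_block m X ** upper_block m (mat 1) = upper_block m (mat 1) ** upper_block m X"
    unfolding upper_block_one_mult mult_upper_block_one
    by (simp add: upper_block_def vec_eq_iff)
qed simp

lemma block_power_cong:
  "upper_block m X = upper_block m X' \<Longrightarrow> block_power m k X = block_power m k X'"
  by (simp add: block_power_def)

text \<open>The inverse of a matrix commuting with the projector commutes with it too, so both
  projectors of \<open>upper_block_eq\<close> can be moved inwards to \<open>X\<close>.\<close>

lemma upper_block_conjugate:
  assumes gh: "g ** h = mat 1" "h ** g = mat 1"
    and g: "g ** upper_block m (mat 1) = upper_block m (mat 1) ** g"
  shows "upper_block m (g ** X ** h) = g ** upper_block m X ** h"
proof -
  let ?E = "upper_block m (mat 1)"
  have "h ** ?E = h ** (?E ** g) ** h"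
    by (simp add: matrix_mul_assoc[symmetric] gh(1))
  also have "\<dots> = ?E ** h"
    unfolding g[symmetric] by (simp add: matrix_mul_assoc gh(2))
  finally have h: "h ** ?E = ?E ** h" .
  have "upper_block m (g ** X ** h) = (?E ** g) ** X ** (h ** ?E)"
    unfolding upper_block_eq[of m "g ** X ** h"] by (simp add: matrix_mul_assoc)
  also have "\<dots> = g ** upper_block m X ** h"
    unfolding upper_block_eq[of m X] g[symmetric] h by (simp add: matrix_mul_assoc)
  finally show ?thesis .
qed

section \<open>Inverses of exponentials\<close>

lemma mexp_mult_minus: "mexp (z *\<^sub>C B) ** mexp ((- z) *\<^sub>C B) = mat 1"
proof -
  have "0 *\<^sub>C B = 0" by (simp add: vec_eq_iff scaleC_mat_nth)
  then show ?thesis using mexp_add[of z "- z" B] by (simp add: mexp_zero)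
qed

lemma mexp_minus_mult: "mexp ((- z) *\<^sub>C B) ** mexp (z *\<^sub>C B) = mat 1"
  using mexp_mult_minus[of "- z" B] by simp

lemma invertible_mexp: "invertible (mexp (z *\<^sub>C B))"
  unfolding invertible_def by (intro exI conjI) (rule mexp_mult_minus, rule mexp_minus_mult)

text \<open>\<open>matrix_inv\<close> is a Hilbert choice among two-sided inverses, and
  associativity leaves only one candidate.\<close>

lemma matrix_inv_eqI:
  assumes "g ** h = mat 1" "h ** g = mat 1"
  shows "matrix_inv g = h"
proof -
  have "g ** matrix_inv g = mat 1 \<and> matrix_inv g ** g = mat 1"
    unfolding matrix_inv_def
    by (rule someI[of "\<lambda>h. g ** h = mat 1 \<and> h ** g = mat 1" h]) (simp add: assms)
  then have "matrix_inv g ** (g ** h) = h" by (simp add: matrix_mul_assoc)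
  then show ?thesis by (simp add: assms(1))
qed

lemma mexp_scaleC_commute:
  "K ** B = B ** K \<Longrightarrow> K ** mexp (z *\<^sub>C B) = mexp (z *\<^sub>C B) ** K"
  by (rule mexp_intertwine) (simp add: mat_mult_scaleC scaleC_mat_mult)

text \<open>The exponent is a scalar times a polynomial expression in the matrix, built from
  products with the constant projector; composition with \<open>mexp\<close> finishes.\<close>

lemma cholomorphic_on_mexp_block_power:
  "cholomorphic_on (\<lambda>x. mexp (fst x *\<^sub>C block_power m k (snd x)) :: 'n::{finite, linorder} cmat) S"
proof -
  have "cholomorphic_on (\<lambda>X :: 'n cmat. upper_block m (mat 1) ** X ** upper_block m (mat 1)) S" for S
    by (intro cholomorphic_on_matrix_mult cholomorphic_on_const cholomorphic_on_ident)
  then have block: "cholomorphic_on (\<lambda>X :: 'n cmat. upper_block m X) S" for S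
    by (simp only: upper_block_eq[symmetric])
  have "cholomorphic_on (block_power m k :: 'n cmat \<Rightarrow> 'n cmat) UNIV"
    unfolding block_power_def[abs_def]
    by (induction k) (simp_all add: cholomorphic_on_const cholomorphic_on_matrix_mult block)
  then have "cholomorphic_on (\<lambda>x :: complex \<times> 'n cmat. fst x *\<^sub>C block_power m k (snd x)) S"
    by (intro cholomorphic_on_scaleC cholomorphic_on_fst
        cholomorphic_on_compose[OF cholomorphic_on_snd]) auto
  then show ?thesis
    by (rule cholomorphic_on_compose[OF _ cholomorphic_on_mexp]) (rule subset_UNIV)
qed

section \<open>The flows\<close>

text \<open>The group law and the commutation of the flows are algebraic, so they are derived here
  before any chart enters.\<close>

locale equivariant_map =
  fixes M :: "'m set"
    and act :: "'n::{finite, linorder} cmat \<Rightarrow> 'm \<Rightarrow> 'm"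
    and \<mu> :: "'m \<Rightarrow> 'n cmat"
  assumes act_in: "invertible g \<Longrightarrow> p \<in> M \<Longrightarrow> act g p \<in> M"
    and act_one: "p \<in> M \<Longrightarrow> act (mat 1) p = p"
    and act_mult: "invertible g \<Longrightarrow> invertible h \<Longrightarrow> p \<in> M \<Longrightarrow> act (g ** h) p = act g (act h p)"
    and equivariant: "invertible g \<Longrightarrow> p \<in> M \<Longrightarrow> \<mu> (act g p) = g ** \<mu> p ** matrix_inv g"
begin

abbreviation flow :: "nat \<Rightarrow> nat \<Rightarrow> complex \<Rightarrow> 'm \<Rightarrow> 'm"
  where "flow m i z \<equiv> gz_flow M act \<mu> m i z"

lemma flow_eq: "p \<in> M \<Longrightarrow> flow m i z p = act (mexp (z *\<^sub>C block_power m (i - 1) (\<mu> p))) p"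
  by (simp add: gz_flow_def)

lemma flow_in: "p \<in> M \<Longrightarrow> flow m i z p \<in> M"
  by (simp add: flow_eq act_in invertible_mexp)

lemma moment_flow:
  assumes "p \<in> M"
  shows "\<mu> (flow m i z p) =
    mexp (z *\<^sub>C block_power m (i - 1) (\<mu> p)) ** \<mu> p ** mexp ((- z) *\<^sub>C block_power m (i - 1) (\<mu> p))"
  by (simp add: flow_eq equivariant invertible_mexp assms
      matrix_inv_eqI[OF mexp_mult_minus mexp_minus_mult])

text \<open>In this statement \<open>i\<close> is the block size of the flow and \<open>m\<close>
  that of the observed block. The moving element is the exponential of a matrix in gl(i), hence
  commutes with the projector of size m, and conjugation commutes with cutting out the
  block.\<close>

lemma upper_block_moment_flow:
  assumes p: "p \<in> M" and "i \<le> m"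
  shows "upper_block m (\<mu> (flow i j z p)) =
    mexp (z *\<^sub>C block_power i (j - 1) (\<mu> p)) ** upper_block m (\<mu> p) **
    mexp ((- z) *\<^sub>C block_power i (j - 1) (\<mu> p))"
  unfolding moment_flow[OF p]
  by (intro upper_block_conjugate mexp_mult_minus mexp_minus_mult mexp_scaleC_commute[symmetric])
    (simp add: upper_block_one_block_power[OF \<open>i \<le> m\<close>])

text \<open>The flow of an invariant of the \<open>m\<close>-th block conjugates that block by an element commuting
  with it.\<close>

lemma upper_block_moment_flow_invariant:
  assumes p: "p \<in> M" and "l \<le> m"
  shows "upper_block l (\<mu> (flow m i z p)) = upper_block l (\<mu> p)"
proof -
  let ?B = "block_power m (i - 1) (\<mu> p)" and ?Y = "upper_block m (\<mu> p)"
  have "upper_block m (\<mu> (flow m i z p)) = (mexp (z *\<^sub>C ?B) ** ?Y) ** mexp ((- z) *\<^sub>C ?B)"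
    by (rule upper_block_moment_flow[OF p order_refl])
  also have "\<dots> = ?Y ** (mexp (z *\<^sub>C ?B) ** mexp ((- z) *\<^sub>C ?B))"
    unfolding mexp_scaleC_commute[OF upper_block_mult_block_power, symmetric]
    by (simp add: matrix_mul_assoc)
  finally have "upper_block m (\<mu> (flow m i z p)) = ?Y" by (simp only: mexp_mult_minus matrix_mul_rid)
  then show ?thesis
    using upper_block_upper_block[OF \<open>l \<le> m\<close>] by metis
qed

lemma block_power_moment_flow_invariant:
  "p \<in> M \<Longrightarrow> l \<le> m \<Longrightarrow> block_power l k (\<mu> (flow m i z p)) = block_power l k (\<mu> p)"
  by (rule block_power_cong[OF upper_block_moment_flow_invariant])

text \<open>The outer exponent is evaluated at the moved point; invariance replaces it by the one at
  \<open>p\<close>, so that both exponents are multiples of one matrix.\<close>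

lemma flow_add:
  assumes p: "p \<in> M"
  shows "flow m i (z + w) p = flow m i z (flow m i w p)"
proof -
  have "flow m i z (flow m i w p) = act (mexp (z *\<^sub>C block_power m (i - 1) (\<mu> p))) (flow m i w p)"
    by (simp add: flow_eq[OF flow_in[OF p]] block_power_moment_flow_invariant[OF p])
  then show ?thesis
    by (simp add: flow_eq[OF p] mexp_add act_mult invertible_mexp p)
qed

lemma flow_zero: "p \<in> M \<Longrightarrow> flow m i 0 p = p"
proof -
  have "0 *\<^sub>C B = 0" for B :: "'n cmat" by (simp add: vec_eq_iff scaleC_mat_nth)
  then show "p \<in> M \<Longrightarrow> flow m i 0 p = p" by (simp add: flow_eq mexp_zero act_one)
qed

lemma flow_commute_le:
  assumes p: "p \<in> M" and lm: "l \<le> m"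
  shows "flow m i z (flow l j w p) = flow l j w (flow m i z p)"
proof -
  define B where "B = block_power m (i - 1) (\<mu> p)"
  define C where "C = block_power l (j - 1) (\<mu> p)"
  define B' where "B' = block_power m (i - 1) (\<mu> (flow l j w p))"
  define h where "h = mexp (w *\<^sub>C C)"
  have flow: "flow m i z p = act (mexp (z *\<^sub>C B)) p" "flow l j w p = act h p"
    by (simp_all add: flow_eq p B_def C_def h_def)
  have inv_h: "invertible h" by (simp add: h_def invertible_mexp)
  \<comment> \<open>\<open>h\<close> need not commute with \<open>B\<close>, since the flow of the
    smaller block can change the larger one; it carries the generator at \<open>p\<close> to the
    generator at the moved point.\<close>
  have "h ** B = B' ** h"
    unfolding B_def B'_def
  proof (rule block_power_intertwine)
    have "upper_block m (\<mu> (flow l j w p)) ** h =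
        h ** upper_block m (\<mu> p) ** (mexp ((- w) *\<^sub>C C) ** h)"
      unfolding upper_block_moment_flow[OF p lm] h_def C_def by (simp add: matrix_mul_assoc)
    then show "h ** upper_block m (\<mu> p) = upper_block m (\<mu> (flow l j w p)) ** h"
      by (simp only: h_def mexp_minus_mult matrix_mul_rid)
    show "h ** upper_block m (mat 1) = upper_block m (mat 1) ** h"
      unfolding h_def C_def
      by (rule mexp_scaleC_commute[symmetric]) (simp add: upper_block_one_block_power[OF lm])
  qed
  then have h: "h ** mexp (z *\<^sub>C B) = mexp (z *\<^sub>C B') ** h"
    by (intro mexp_intertwine) (simp add: mat_mult_scaleC scaleC_mat_mult)
  have "flow m i z (flow l j w p) = act (mexp (z *\<^sub>C B')) (act h p)"
    by (simp add: flow_eq[OF flow_in[OF p], of m] B'_def flip: flow(2))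
  also have "\<dots> = act (h ** mexp (z *\<^sub>C B)) p"
    by (simp add: h act_mult invertible_mexp inv_h p)
  also have "\<dots> = act h (flow m i z p)"
    by (simp add: flow act_mult invertible_mexp inv_h p)
  \<comment> \<open>In this order nothing has to be conjugated: \<open>C\<close> is unchanged along
    the flow of the larger block, so the same \<open>h\<close> acts at the new point.\<close>
  also have "\<dots> = flow l j w (flow m i z p)"
    by (simp add: flow_eq[OF flow_in[OF p], of l] block_power_moment_flow_invariant[OF p lm]
        h_def C_def)
  finally show ?thesis .
qed

lemma flow_commute: "p \<in> M \<Longrightarrow> flow m i z (flow l j w p) = flow l j w (flow m i z p)"
  using flow_commute_le[of p l m i z j w] flow_commute_le[of p m l j w i z] by (cases "l \<le> m") auto

end

section \<open>Holomorphy of the flows\<close>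

lemma open_GL: "open (carrier GL :: 'n::finite cmat set)"
proof -
  have "continuous_on UNIV (det :: 'n cmat \<Rightarrow> complex)"
    unfolding det_def by (intro continuous_intros)
  then have "open (det -` (- {0}) :: 'n cmat set)"
    by (intro open_vimage) auto
  moreover have "carrier GL = (det -` (- {0}) :: 'n cmat set)"
    by (auto simp: GL_def invertible_det_nz)
  ultimately show ?thesis by simp
qed

lemma equivariant_map_of_moment_map:
  assumes "GL_action M A act" "equivariant_moment_map M A \<omega> act \<mu>"
  shows "equivariant_map M act \<mu>"
proof -
  interpret group_action GL M act
    using assms(1) unfolding GL_action_def holomorphic_action_def by blast
  show ?thesis
  proof
    show "act g p \<in> M" if "invertible g" "p \<in> M" for g p
      using element_image[of g p "act g p"] that by (simp add: GL_def)
    show "act (mat 1) p = p" if "p \<in> M" for p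
      using fun_cong[OF id_eq_one, of p] that by (simp add: GL_def)
    show "act (g ** h) p = act g (act h p)" if "invertible g" "invertible h" "p \<in> M" for g h p
      using composition_rule[of p g h] that by (simp add: GL_def)
    show "\<mu> (act g p) = g ** \<mu> p ** matrix_inv g" if "invertible g" "p \<in> M" for g p
      using assms(2) that unfolding equivariant_moment_map_def by (simp add: GL_def)
  qed
qed

text \<open>The flow is factored as (z, p) |-> (z, \<mu> p) |-> \<open>e\<close>, which takes values
  in \<open>GL\<close> as exponentials are invertible; this is paired with p and followed by the
  action map on GL x M.\<close>

lemma vector_space_action_gz_flow:
  fixes act :: "'n::{finite, linorder} cmat \<Rightarrow> 'm::{t2_space, second_countable_topology} \<Rightarrow> 'm"
  assumes M: "complex_manifold M A" and act: "GL_action M A act"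
    and \<mu>: "equivariant_moment_map M A \<omega> act \<mu>"
  shows "vector_space_action M A (gz_flow M act \<mu> m i)"
proof -
  interpret equivariant_map M act \<mu> by (rule equivariant_map_of_moment_map[OF act \<mu>])
  have C: "complex_manifold (UNIV :: complex set) (open_atlas UNIV)"
    by (rule complex_manifold_open_atlas[OF open_UNIV])
  have V: "complex_manifold (UNIV :: 'n cmat set) (open_atlas UNIV)"
    by (rule complex_manifold_open_atlas[OF open_UNIV])
  have G: "complex_manifold (carrier GL :: 'n cmat set) (open_atlas (carrier GL))"
    by (rule complex_manifold_open_atlas[OF open_GL])
  note CM = complex_manifold_prod[OF C M] and CV = complex_manifold_prod[OF C V]
    and GM = complex_manifold_prod[OF G M]
  have hol_\<mu>: "holomorphic_map M A UNIV (open_atlas UNIV) \<mu>"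
    using \<mu> unfolding equivariant_moment_map_def by blast
  have hol_act: "holomorphic_map (carrier GL \<times> M) (prod_atlas (open_atlas (carrier GL)) A) M A
      (\<lambda>(g, p). act g p)"
    using act unfolding GL_action_def holomorphic_action_def by blast
  define e where "e x = mexp (fst x *\<^sub>C block_power m (i - 1) (snd x))" for x :: "complex \<times> 'n cmat"
  have "holomorphic_map (UNIV \<times> UNIV) (open_atlas (UNIV \<times> UNIV)) (carrier GL) (open_atlas (carrier GL)) e"
    unfolding e_def[abs_def]
    by (rule cholomorphic_on_imp_holomorphic_map[OF cholomorphic_on_mexp_block_power])
      (auto simp: GL_def invertible_mexp)
  then have hol_e: "holomorphic_map (UNIV \<times> UNIV) (prod_atlas (open_atlas UNIV) (open_atlas UNIV))
      (carrier GL) (open_atlas (carrier GL)) e"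
    by (simp only: prod_open_atlas)
  have "holomorphic_map (UNIV \<times> M) (prod_atlas (open_atlas UNIV) A)
      (UNIV \<times> UNIV) (prod_atlas (open_atlas UNIV) (open_atlas UNIV)) (\<lambda>x. (fst x :: complex, \<mu> (snd x)))"
    by (rule holomorphic_map_Pair[OF holomorphic_map_fst[OF C M]
          holomorphic_map_compose[OF CM M holomorphic_map_snd[OF C M] hol_\<mu>]])
  then have "holomorphic_map (UNIV \<times> M) (prod_atlas (open_atlas UNIV) A)
      (carrier GL) (open_atlas (carrier GL)) (\<lambda>x. e (fst x, \<mu> (snd x)))"
    by (rule holomorphic_map_compose[OF CM CV _ hol_e])
  then have "holomorphic_map (UNIV \<times> M) (prod_atlas (open_atlas UNIV) A)
      (carrier GL \<times> M) (prod_atlas (open_atlas (carrier GL)) A) (\<lambda>x. (e (fst x, \<mu> (snd x)), snd x))"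
    by (rule holomorphic_map_Pair[OF _ holomorphic_map_snd[OF C M]])
  then have "holomorphic_map (UNIV \<times> M) (prod_atlas (open_atlas UNIV) A) M A
      (\<lambda>x. (\<lambda>(g, p). act g p) (e (fst x, \<mu> (snd x)), snd x))"
    by (rule holomorphic_map_compose[OF CM GM _ hol_act])
  then have "holomorphic_map (UNIV \<times> M) (prod_atlas (open_atlas UNIV) A) M A
      (\<lambda>(z, p). gz_flow M act \<mu> m i z p)"
    by (rule holomorphic_map_cong[OF CM]) (auto simp: e_def flow_eq)
  moreover have "gz_flow M act \<mu> m i z \<in> extensional M" for z
    by (simp add: gz_flow_def)
  ultimately show ?thesis
    unfolding vector_space_action_iff using flow_in flow_zero flow_add by blast
qed

text \<open>Moves a condition between admissible pairs, on which \<open>Abs_gz_index\<close> and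
  \<open>Rep_gz_index\<close> are mutually inverse, and the index type. \<open>P\<close> receives
  the index beside the two numbers so that it can speak of an axis and of a flow at once.\<close>

lemma all_gz_index_iff:
  "(\<forall>m i. 1 \<le> i \<and> i \<le> m \<and> m \<le> CARD('n) \<longrightarrow> P (Abs_gz_index (m, i)) m i) \<longleftrightarrow>
   (\<forall>k :: 'n::finite gz_index. P k (fst (Rep_gz_index k)) (snd (Rep_gz_index k)))"
  (is "?L \<longleftrightarrow> ?R")
proof
  assume ?L
  show ?R
  proof
    fix k :: "'n gz_index"
    show "P k (fst (Rep_gz_index k)) (snd (Rep_gz_index k))"
      using \<open>?L\<close> Rep_gz_index[of k] Rep_gz_index_inverse[of k] by (cases "Rep_gz_index k") auto
  qed
next
  assume R: ?R
  show ?L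
  proof (intro allI impI)
    fix m i
    assume "1 \<le> i \<and> i \<le> m \<and> m \<le> CARD('n)"
    then have "Rep_gz_index (Abs_gz_index (m, i) :: 'n gz_index) = (m, i)"
      by (intro Abs_gz_index_inverse) simp
    then show "P (Abs_gz_index (m, i)) m i"
      using R[rule_format, of "Abs_gz_index (m, i)"] by simp
  qed
qed

theorem corollary5p6:
  fixes M :: "'m::{t2_space, second_countable_topology} set"
    and A :: "('m, 'e::complex_fd_space) chart set"
    and \<omega> :: "('m, 'e) two_form"
    and act :: "'n::{finite, linorder} cmat \<Rightarrow> 'm \<Rightarrow> 'm"
    and \<mu> :: "'m \<Rightarrow> 'n cmat"
  assumes "complex_symplectic_manifold M A \<omega>"
    and "GL_action M A act"
    and "equivariant_moment_map M A \<omega> act \<mu>"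
  shows "(\<forall>m i. 1 \<le> i \<and> i \<le> m \<and> m \<le> CARD('n) \<longrightarrow>
            vector_space_action M A (gz_flow M act \<mu> m i)) \<and>
         (\<forall>m i l j. 1 \<le> i \<and> i \<le> m \<and> m \<le> CARD('n) \<and> 1 \<le> j \<and> j \<le> l \<and> l \<le> CARD('n) \<longrightarrow>
            (\<forall>z w. \<forall>p\<in>M.
              gz_flow M act \<mu> m i z (gz_flow M act \<mu> l j w p) =
              gz_flow M act \<mu> l j w (gz_flow M act \<mu> m i z p))) \<and>
         (\<exists>!\<rho> :: complex ^ 'n gz_index \<Rightarrow> 'm \<Rightarrow> 'm.
            vector_space_action M A \<rho> \<and>
            (\<forall>m i z. 1 \<le> i \<and> i \<le> m \<and> m \<le> CARD('n) \<longrightarrow>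
              \<rho> (axis (Abs_gz_index (m, i)) z) = gz_flow M act \<mu> m i z))"
proof -
  have M: "complex_manifold M A"
    using assms(1) unfolding complex_symplectic_manifold_def by blast
  interpret equivariant_map M act \<mu> by (rule equivariant_map_of_moment_map[OF assms(2,3)])
  note flow_action = vector_space_action_gz_flow[OF M assms(2,3)]
  define \<phi> where "\<phi> k = flow (fst (Rep_gz_index k)) (snd (Rep_gz_index k))" for k :: "'n gz_index"
  interpret commuting_actions M A \<phi>
    by standard (simp_all add: \<phi>_def M flow_action flow_commute)
  \<comment> \<open>The values prescribed on the axes are exactly the reindexed family
    \<open>\<phi>\<close>, so \<open>ex1_joint_action\<close> applies to the last conjunct.\<close>
  have gens: "(\<forall>m i z. 1 \<le> i \<and> i \<le> m \<and> m \<le> CARD('n) \<longrightarrow>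
      \<rho> (axis (Abs_gz_index (m, i)) z) = flow m i z) \<longleftrightarrow> (\<forall>k z. \<rho> (axis k z) = \<phi> k z)"
    for \<rho> :: "complex ^ 'n gz_index \<Rightarrow> 'm \<Rightarrow> 'm"
    using all_gz_index_iff[where 'n = 'n, of "\<lambda>k m i. \<forall>z. \<rho> (axis k z) = flow m i z"]
    by (simp add: \<phi>_def)
  show ?thesis
    unfolding gens using flow_action flow_commute ex1_joint_action by blast
qed

end
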